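(* Let $\mathsf{C}$ be a category and $\Phi$ a Riguet congruence on $\mathsf{C}$. If there exists a choice function for $(\mathrm{Hom}_{\mathsf{C}}(a,b))_{(a,b)\in\Phi^{\mathrm{ob}}}$ that is $\Phi$-compatible, then the canonical functor $\alpha_{(\mathsf{C},\Phi)}\colon\mathsf{C}/\Phi\to\mathsf{C}/\Phi^{\natural}$ is an equivalence.
   Context: Hom-sets of a category are assumed pairwise disjoint. A Riguet congruence on a category $\mathsf{C}$ is a pair $\Phi=(\Phi^{\mathrm{ob}},\Phi^{\mathrm{fl}})$ where $\Phi^{\mathrm{ob}}$ is an equivalence relation on $\mathrm{Ob}(\mathsf{C})$ and $\Phi^{\mathrm{fl}}$ assigns to all $(a,a'),(b,b')\in\Phi^{\mathrm{ob}}$ a subset $\Phi^{\mathrm{fl}}_{\left(\begin{smallmatrix}a&b\\ a'&b'\end{smallmatrix}\right)}\subseteq\mathrm{Hom}_{\mathsf{C}}(a,b)\times\mathrm{Hom}_{\mathsf{C}}(a',b')$ such that: (Ra) if $(a,b)\in\Phi^{\mathrm{ob}}$, then $(\mathrm{id}_a,\mathrm{id}_b)\in\Phi^{\mathrm{fl}}_{\left(\begin{smallmatrix}a&a\\ b&b\end{smallmatrix}\right)}$; (Rb) if $f\in\mathrm{Hom}_{\mathsf{C}}(a,b)$, then $(f,f)\in\Phi^{\mathrm{fl}}_{\left(\begin{smallmatrix}a&b\\ a&b\end{smallmatrix}\right)}$; (Rc) if $(f,f')\in\Phi^{\mathrm{fl}}_{\left(\begin{smallmatrix}a&b\\ a'&b'\end{smallmatrix}\right)}$,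 then $(f',f)\in\Phi^{\mathrm{fl}}_{\left(\begin{smallmatrix}a'&b'\\ a&b\end{smallmatrix}\right)}$; (Rd) if $(f,f')\in\Phi^{\mathrm{fl}}_{\left(\begin{smallmatrix}a&b\\ a'&b'\end{smallmatrix}\right)}$ and $(f',f'')\in\Phi^{\mathrm{fl}}_{\left(\begin{smallmatrix}a'&b'\\ a''&b''\end{smallmatrix}\right)}$, then $(f,f'')\in\Phi^{\mathrm{fl}}_{\left(\begin{smallmatrix}a&b\\ a''&b''\end{smallmatrix}\right)}$; (Re) if $(f,f')\in\Phi^{\mathrm{fl}}_{\left(\begin{smallmatrix}a&b\\ a'&b'\end{smallmatrix}\right)}$ and $(g,g')\in\Phi^{\mathrm{fl}}_{\left(\begin{smallmatrix}b&c\\ b'&c'\end{smallmatrix}\right)}$, then $(g\circ f,g'\circ f')\in\Phi^{\mathrm{fl}}_{\left(\begin{smallmatrix}a&c\\ a'&c'\end{smallmatrix}\right)}$; (Rf) for all $(a,a'),(b,b')\in\Phi^{\mathrm{ob}}$ and $f\in\mathrm{Hom}_{\mathsf{C}}(a,b)$ there is $f'\in\mathrm{Hom}_{\mathsf{C}}(a',b')$ with $(f,f')\in\Phi^{\mathrm{fl}}_{\left(\begin{smallmatrix}a&b\\ a'&b'\end{smallmatrix}\right)}$. The Riguet quotient $\mathsf{C}/\Phi$ is the category whose objects are the $\Phi^{\mathrm{ob}}$-classes $[a]$; whose morphisms from $[a]$ to $[b]$ are the classes $[f]$ of elements $f$ of $\bigcup_{a'\in[a],b'\in[b]}\mathrm{Hom}_{\mathsf{C}}(a',b')$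 under the equivalence relation $\bigcup_{a',a''\in[a];\,b',b''\in[b]}\Phi^{\mathrm{fl}}_{\left(\begin{smallmatrix}a'&b'\\ a''&b''\end{smallmatrix}\right)}$; whose identities are $[\mathrm{id}_a]$; and where, for $f\colon a'\to b'$, $g\colon b''\to c'$ with $(b',b'')\in\Phi^{\mathrm{ob}}$, $[g]\circ[f]=[g\circ h]$ for any $h\colon a'\to b''$ with $(f,h)\in\Phi^{\mathrm{fl}}_{\left(\begin{smallmatrix}a'&b'\\ a'&b''\end{smallmatrix}\right)}$. The projection $P_\Phi\colon\mathsf{C}\to\mathsf{C}/\Phi$ is $a\mapsto[a]$, $f\mapsto[f]$. Let $\mathrm{sc}(f)$, $\mathrm{tg}(f)$ be source and target, $\mathrm{Mor}(\mathsf{C})^{+}$ the set of finite nonempty sequences of morphisms of $\mathsf{C}$, $(f)$ the length-one sequence, $\curlywedge$ concatenation; for an equivalence relation $E$ on $\mathrm{Ob}(\mathsf{C})$, $\mathrm{Mor}(\mathsf{C})^{+}_{E}$ is the set of $(f_i)_{i\in m}$ with $(\mathrm{tg}(f_i),\mathrm{sc}(f_{i+1}))\in E$ for every $i\in m-1$. A generalized congruence on $\mathsf{C}$ is a pair $\Psi=(\Psi^{\mathrm{ob}},\Psi^{\mathrm{fl}})$ where $\Psi^{\mathrm{ob}}$ is an equivalence relation on $\mathrm{Ob}(\mathsf{C})$ and $\Psi^{\mathrm{fl}}$ is an equivalence relation on $\mathrm{Mor}(\mathsf{C})^{+}_{\Psi^{\mathrm{ob}}}$ such that: (a) if $(a,b)\in\Psi^{\mathrm{ob}}$,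 then $((\mathrm{id}_a),(\mathrm{id}_b))\in\Psi^{\mathrm{fl}}$; (b) if $((f_i)_{i\in m},(g_j)_{j\in n})\in\Psi^{\mathrm{fl}}$, then $(\mathrm{sc}(f_0),\mathrm{sc}(g_0))\in\Psi^{\mathrm{ob}}$ and $(\mathrm{tg}(f_{m-1}),\mathrm{tg}(g_{n-1}))\in\Psi^{\mathrm{ob}}$; (c) if $\mathrm{sc}(g)=\mathrm{tg}(f)$, then $((f,g),(g\circ f))\in\Psi^{\mathrm{fl}}$; (d) if $((f_i)_{i\in m},(f'_{i'})_{i'\in m'}),((g_j)_{j\in n},(g'_{j'})_{j'\in n'})\in\Psi^{\mathrm{fl}}$ and $(\mathrm{tg}(f_{m-1}),\mathrm{sc}(g_0))\in\Psi^{\mathrm{ob}}$, then $((f_i)_{i\in m}\curlywedge(g_j)_{j\in n},(f'_{i'})_{i'\in m'}\curlywedge(g'_{j'})_{j'\in n'})\in\Psi^{\mathrm{fl}}$. The quotient $\mathsf{C}/\Psi$ has as objects the $\Psi^{\mathrm{ob}}$-classes, as morphisms $[a]\to[b]$ the $\Psi^{\mathrm{fl}}$-classes of sequences $(f_i)_{i\in m}\in\mathrm{Mor}(\mathsf{C})^{+}_{\Psi^{\mathrm{ob}}}$ with $\mathrm{sc}(f_0)\in[a]$ and $\mathrm{tg}(f_{m-1})\in[b]$, composition induced by concatenation ($[v]\circ[u]=[u\curlywedge v]$) and identities $[(\mathrm{id}_a)]$; $P_\Psi\colon\mathsf{C}\to\mathsf{C}/\Psi$ is $a\mapsto[a]$,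 $f\mapsto[(f)]$. $\Phi^{\natural}$ is the smallest (coordinatewise) generalized congruence $\Psi$ on $\mathsf{C}$ with $\Phi^{\mathrm{ob}}\subseteq\Psi^{\mathrm{ob}}$ and $((f),(f'))\in\Psi^{\mathrm{fl}}$ whenever $(f,f')$ lies in some component of $\Phi^{\mathrm{fl}}$; its object part is $\Phi^{\mathrm{ob}}$. $\alpha_{(\mathsf{C},\Phi)}$ is the unique functor with $\alpha_{(\mathsf{C},\Phi)}\circ P_{\Phi}=P_{\Phi^{\natural}}$. A choice function $F$ for $(\mathrm{Hom}_{\mathsf{C}}(a,b))_{(a,b)\in\Phi^{\mathrm{ob}}}$ (so $F(a,b)\in\mathrm{Hom}_{\mathsf{C}}(a,b)$ for $(a,b)\in\Phi^{\mathrm{ob}}$) is $\Phi$-compatible if $F(a,a)=\mathrm{id}_a$ for every object $a$ and, whenever $(a,a'),(b,b'),(a,b),(a',b')\in\Phi^{\mathrm{ob}}$, $(F(a,b),F(a',b'))\in\Phi^{\mathrm{fl}}_{\left(\begin{smallmatrix}a&b\\ a'&b'\end{smallmatrix}\right)}$. *)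

theory Defs
  imports "HOL-Library.FuncSet"
begin

section \<open>Categories, functors and equivalences\<close>

text \<open>
  A category has a carrier set of objects and a family of hom-sets indexed by pairs of objects;
  \<^term>\<open>cmp C g f\<close> is \<open>g \<circ> f\<close>. All fields are only meaningful on the carriers.
\<close>

record ('o, 'm) cat =
  Ob  :: "'o set"
  Hom :: "'o \<Rightarrow> 'o \<Rightarrow> 'm set"
  idm :: "'o \<Rightarrow> 'm"
  cmp :: "'m \<Rightarrow> 'm \<Rightarrow> 'm"

locale category =
  fixes C :: "('o, 'm) cat"
  assumes hom_disjoint:
      "\<lbrakk>a \<in> Ob C; b \<in> Ob C; a' \<in> Ob C; b' \<in> Ob C; (a, b) \<noteq> (a', b')\<rbrakk>
        \<Longrightarrow> Hom C a b \<inter> Hom C a' b' = {}"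
    and id_hom: "a \<in> Ob C \<Longrightarrow> idm C a \<in> Hom C a a"
    and cmp_hom:
      "\<lbrakk>a \<in> Ob C; b \<in> Ob C; c \<in> Ob C; f \<in> Hom C a b; g \<in> Hom C b c\<rbrakk>
        \<Longrightarrow> cmp C g f \<in> Hom C a c"
    and id_right: "\<lbrakk>a \<in> Ob C; b \<in> Ob C; f \<in> Hom C a b\<rbrakk> \<Longrightarrow> cmp C f (idm C a) = f"
    and id_left: "\<lbrakk>a \<in> Ob C; b \<in> Ob C; f \<in> Hom C a b\<rbrakk> \<Longrightarrow> cmp C (idm C b) f = f"
    and cmp_assoc:
      "\<lbrakk>a \<in> Ob C; b \<in> Ob C; c \<in> Ob C; d \<in> Ob C;
        f \<in> Hom C a b; g \<in> Hom C b c; h \<in> Hom C c d\<rbrakk>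
        \<Longrightarrow> cmp C h (cmp C g f) = cmp C (cmp C h g) f"

definition Mor :: "('o, 'm) cat \<Rightarrow> 'm set" where
  "Mor C = (\<Union>a \<in> Ob C. \<Union>b \<in> Ob C. Hom C a b)"

definition sc :: "('o, 'm) cat \<Rightarrow> 'm \<Rightarrow> 'o" where
  "sc C f = (THE a. a \<in> Ob C \<and> (\<exists>b \<in> Ob C. f \<in> Hom C a b))"

definition tg :: "('o, 'm) cat \<Rightarrow> 'm \<Rightarrow> 'o" where
  "tg C f = (THE b. b \<in> Ob C \<and> (\<exists>a \<in> Ob C. f \<in> Hom C a b))"

record ('o, 'm, 'p, 'n) func =
  onob :: "'o \<Rightarrow> 'p"
  onmor :: "'m \<Rightarrow> 'n"

text \<open>
  The two components are required to be extensional, i.e. \<^const>\<open>undefined\<close> outside the objects,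
  respectively morphisms, of the source, so that HOL equality of functors is the mathematical one.
\<close>

locale cat_functor = source: category C + target: category D
  for C :: "('o, 'm) cat" and D :: "('p, 'n) cat" +
  fixes T :: "('o, 'm, 'p, 'n) func"
  assumes ob_extensional: "onob T \<in> extensional (Ob C)"
    and mor_extensional: "onmor T \<in> extensional (Mor C)"
    and ob_map: "a \<in> Ob C \<Longrightarrow> onob T a \<in> Ob D"
    and mor_map:
      "\<lbrakk>a \<in> Ob C; b \<in> Ob C; f \<in> Hom C a b\<rbrakk> \<Longrightarrow> onmor T f \<in> Hom D (onob T a) (onob T b)"
    and map_id: "a \<in> Ob C \<Longrightarrow> onmor T (idm C a) = idm D (onob T a)"
    and map_cmp:
      "\<lbrakk>a \<in> Ob C; b \<in> Ob C; c \<in> Ob C; f \<in> Hom C a b; g \<in> Hom C b c\<rbrakk>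
        \<Longrightarrow> onmor T (cmp C g f) = cmp D (onmor T g) (onmor T f)"

definition func_id :: "('o, 'm) cat \<Rightarrow> ('o, 'm, 'o, 'm) func" where
  "func_id C = \<lparr>onob = (\<lambda>a \<in> Ob C. a), onmor = (\<lambda>f \<in> Mor C. f)\<rparr>"

text \<open>\<open>func_comp C U T\<close> is \<open>U \<circ> T\<close>, where \<open>C\<close> is the source of \<open>T\<close>.\<close>

definition func_comp ::
  "('o, 'm) cat \<Rightarrow> ('p, 'n, 'q, 'k) func \<Rightarrow> ('o, 'm, 'p, 'n) func \<Rightarrow> ('o, 'm, 'q, 'k) func" where
  "func_comp C U T =
    \<lparr>onob = compose (Ob C) (onob U) (onob T), onmor = compose (Mor C) (onmor U) (onmor T)\<rparr>"

definition iso_in :: "('o, 'm) cat \<Rightarrow> 'o \<Rightarrow> 'o \<Rightarrow> 'm \<Rightarrow> bool" where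
  "iso_in C a b f \<longleftrightarrow> f \<in> Hom C a b \<and>
    (\<exists>g \<in> Hom C b a. cmp C g f = idm C a \<and> cmp C f g = idm C b)"

definition naturally_isomorphic ::
  "('o, 'm) cat \<Rightarrow> ('p, 'n) cat \<Rightarrow> ('o, 'm, 'p, 'n) func \<Rightarrow> ('o, 'm, 'p, 'n) func \<Rightarrow> bool" where
  "naturally_isomorphic C D S T \<longleftrightarrow> (\<exists>\<tau>.
    (\<forall>a \<in> Ob C. iso_in D (onob S a) (onob T a) (\<tau> a)) \<and>
    (\<forall>a \<in> Ob C. \<forall>b \<in> Ob C. \<forall>f \<in> Hom C a b.
      cmp D (\<tau> b) (onmor S f) = cmp D (onmor T f) (\<tau> a)))"

definition equivalence_functor ::
  "('o, 'm) cat \<Rightarrow> ('p, 'n) cat \<Rightarrow> ('o, 'm, 'p, 'n) func \<Rightarrow> bool" where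
  "equivalence_functor C D T \<longleftrightarrow> cat_functor C D T \<and>
    (\<exists>U. cat_functor D C U \<and>
      naturally_isomorphic C C (func_comp C U T) (func_id C) \<and>
      naturally_isomorphic D D (func_comp D T U) (func_id D))"

section \<open>Riguet congruences and their quotients\<close>

text \<open>
  \<open>rfl \<Phi> a b a' b'\<close> is the component of the flow relation with upper row \<open>a b\<close> and
  lower row \<open>a' b'\<close>; it is only meaningful for \<open>(a, a')\<close> and \<open>(b, b')\<close> in \<open>rob \<Phi>\<close>.
\<close>

record ('o, 'm) riguet =
  rob :: "('o \<times> 'o) set"
  rfl :: "'o \<Rightarrow> 'o \<Rightarrow> 'o \<Rightarrow> 'o \<Rightarrow> ('m \<times> 'm) set"

locale riguet_congruence = category C
  for C :: "('o, 'm) cat" +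
  fixes \<Phi> :: "('o, 'm) riguet"
  assumes rob_equiv: "equiv (Ob C) (rob \<Phi>)"
    and rfl_sub:
      "\<lbrakk>(a, a') \<in> rob \<Phi>; (b, b') \<in> rob \<Phi>\<rbrakk> \<Longrightarrow> rfl \<Phi> a b a' b' \<subseteq> Hom C a b \<times> Hom C a' b'"
    and Ra: "(a, b) \<in> rob \<Phi> \<Longrightarrow> (idm C a, idm C b) \<in> rfl \<Phi> a a b b"
    and Rb: "\<lbrakk>a \<in> Ob C; b \<in> Ob C; f \<in> Hom C a b\<rbrakk> \<Longrightarrow> (f, f) \<in> rfl \<Phi> a b a b"
    and Rc:
      "\<lbrakk>(a, a') \<in> rob \<Phi>; (b, b') \<in> rob \<Phi>; (f, f') \<in> rfl \<Phi> a b a' b'\<rbrakk>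
        \<Longrightarrow> (f', f) \<in> rfl \<Phi> a' b' a b"
    and Rd:
      "\<lbrakk>(a, a') \<in> rob \<Phi>; (b, b') \<in> rob \<Phi>; (a', a'') \<in> rob \<Phi>; (b', b'') \<in> rob \<Phi>;
        (f, f') \<in> rfl \<Phi> a b a' b'; (f', f'') \<in> rfl \<Phi> a' b' a'' b''\<rbrakk>
        \<Longrightarrow> (f, f'') \<in> rfl \<Phi> a b a'' b''"
    and Re:
      "\<lbrakk>(a, a') \<in> rob \<Phi>; (b, b') \<in> rob \<Phi>; (c, c') \<in> rob \<Phi>;
        (f, f') \<in> rfl \<Phi> a b a' b'; (g, g') \<in> rfl \<Phi> b c b' c'\<rbrakk>
        \<Longrightarrow> (cmp C g f, cmp C g' f') \<in> rfl \<Phi> a c a' c'"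
    and Rf:
      "\<lbrakk>(a, a') \<in> rob \<Phi>; (b, b') \<in> rob \<Phi>; f \<in> Hom C a b\<rbrakk>
        \<Longrightarrow> \<exists>f' \<in> Hom C a' b'. (f, f') \<in> rfl \<Phi> a b a' b'"

text \<open>For classes \<open>A\<close>, \<open>B\<close> of objects: the equivalence relation whose classes are the morphisms
  \<open>A \<rightarrow> B\<close> of the quotient.\<close>

definition riguet_rel :: "('o, 'm) riguet \<Rightarrow> 'o set \<Rightarrow> 'o set \<Rightarrow> ('m \<times> 'm) set" where
  "riguet_rel \<Phi> A B = (\<Union>a' \<in> A. \<Union>a'' \<in> A. \<Union>b' \<in> B. \<Union>b'' \<in> B. rfl \<Phi> a' b' a'' b'')"

definition riguet_class :: "('o, 'm) cat \<Rightarrow> ('o, 'm) riguet \<Rightarrow> 'm \<Rightarrow> 'm set" where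
  "riguet_class C \<Phi> f = riguet_rel \<Phi> (rob \<Phi> `` {sc C f}) (rob \<Phi> `` {tg C f}) `` {f}"

text \<open>
  Identities and composition of the quotients below are unions over all choices of representatives
  (and, for the composition in a Riguet quotient, of the auxiliary morphism \<open>h\<close>);
  on composable classes, all these choices yield the same class.
\<close>

definition riguet_quotient :: "('o, 'm) cat \<Rightarrow> ('o, 'm) riguet \<Rightarrow> ('o set, 'm set) cat" where
  "riguet_quotient C \<Phi> =
    \<lparr>Ob = Ob C // rob \<Phi>,
     Hom = (\<lambda>A B. (\<Union>a' \<in> A. \<Union>b' \<in> B. Hom C a' b') // riguet_rel \<Phi> A B),
     idm = (\<lambda>A. \<Union>a \<in> A. riguet_class C \<Phi> (idm C a)),
     cmp = (\<lambda>G F. \<Union>g \<in> G. \<Union>f \<in> F.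
       \<Union>h \<in> {h \<in> Hom C (sc C f) (sc C g). (f, h) \<in> rfl \<Phi> (sc C f) (tg C f) (sc C f) (sc C g)}.
         riguet_class C \<Phi> (cmp C g h))\<rparr>"

definition riguet_proj :: "('o, 'm) cat \<Rightarrow> ('o, 'm) riguet \<Rightarrow> ('o, 'm, 'o set, 'm set) func" where
  "riguet_proj C \<Phi> =
    \<lparr>onob = (\<lambda>a \<in> Ob C. rob \<Phi> `` {a}), onmor = (\<lambda>f \<in> Mor C. riguet_class C \<Phi> f)\<rparr>"

section \<open>Generalized congruences and their quotients\<close>

record ('o, 'm) gcong =
  gob :: "('o \<times> 'o) set"
  gfl :: "('m list \<times> 'm list) set"

definition Mor_plus :: "('o, 'm) cat \<Rightarrow> ('o \<times> 'o) set \<Rightarrow> 'm list set" where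
  "Mor_plus C E = {u. u \<noteq> [] \<and> set u \<subseteq> Mor C \<and>
    (\<forall>i. Suc i < length u \<longrightarrow> (tg C (u ! i), sc C (u ! Suc i)) \<in> E)}"

locale generalized_congruence = category C
  for C :: "('o, 'm) cat" +
  fixes \<Psi> :: "('o, 'm) gcong"
  assumes gob_equiv: "equiv (Ob C) (gob \<Psi>)"
    and gfl_equiv: "equiv (Mor_plus C (gob \<Psi>)) (gfl \<Psi>)"
    and Ga: "(a, b) \<in> gob \<Psi> \<Longrightarrow> ([idm C a], [idm C b]) \<in> gfl \<Psi>"
    and Gb:
      "(u, v) \<in> gfl \<Psi> \<Longrightarrow>
        (sc C (hd u), sc C (hd v)) \<in> gob \<Psi> \<and> (tg C (last u), tg C (last v)) \<in> gob \<Psi>"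
    and Gc:
      "\<lbrakk>f \<in> Mor C; g \<in> Mor C; sc C g = tg C f\<rbrakk> \<Longrightarrow> ([f, g], [cmp C g f]) \<in> gfl \<Psi>"
    and Gd:
      "\<lbrakk>(u, u') \<in> gfl \<Psi>; (v, v') \<in> gfl \<Psi>; (tg C (last u), sc C (hd v)) \<in> gob \<Psi>\<rbrakk>
        \<Longrightarrow> (u @ v, u' @ v') \<in> gfl \<Psi>"

definition gcong_quotient :: "('o, 'm) cat \<Rightarrow> ('o, 'm) gcong \<Rightarrow> ('o set, 'm list set) cat" where
  "gcong_quotient C \<Psi> =
    \<lparr>Ob = Ob C // gob \<Psi>,
     Hom = (\<lambda>A B. {gfl \<Psi> `` {u} | u.
       u \<in> Mor_plus C (gob \<Psi>) \<and> sc C (hd u) \<in> A \<and> tg C (last u) \<in> B}),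
     idm = (\<lambda>A. \<Union>a \<in> A. gfl \<Psi> `` {[idm C a]}),
     cmp = (\<lambda>V U. \<Union>v \<in> V. \<Union>u \<in> U. gfl \<Psi> `` {u @ v})\<rparr>"

definition gcong_proj :: "('o, 'm) cat \<Rightarrow> ('o, 'm) gcong \<Rightarrow> ('o, 'm, 'o set, 'm list set) func" where
  "gcong_proj C \<Psi> =
    \<lparr>onob = (\<lambda>a \<in> Ob C. gob \<Psi> `` {a}), onmor = (\<lambda>f \<in> Mor C. gfl \<Psi> `` {[f]})\<rparr>"

section \<open>The generalized congruence generated by a Riguet congruence\<close>

definition gcong_above :: "('o, 'm) cat \<Rightarrow> ('o, 'm) riguet \<Rightarrow> ('o, 'm) gcong \<Rightarrow> bool" where
  "gcong_above C \<Phi> \<Psi> \<longleftrightarrow> generalized_congruence C \<Psi> \<and> rob \<Phi> \<subseteq> gob \<Psi> \<and>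
    (\<forall>(a, a') \<in> rob \<Phi>. \<forall>(b, b') \<in> rob \<Phi>. \<forall>(f, f') \<in> rfl \<Phi> a b a' b'. ([f], [f']) \<in> gfl \<Psi>)"

definition natural_gcong :: "('o, 'm) cat \<Rightarrow> ('o, 'm) riguet \<Rightarrow> ('o, 'm) gcong" where
  "natural_gcong C \<Phi> = (THE \<Psi>. gcong_above C \<Phi> \<Psi> \<and>
    (\<forall>\<Psi>'. gcong_above C \<Phi> \<Psi>' \<longrightarrow> gob \<Psi> \<subseteq> gob \<Psi>' \<and> gfl \<Psi> \<subseteq> gfl \<Psi>'))"

definition canonical_functor ::
  "('o, 'm) cat \<Rightarrow> ('o, 'm) riguet \<Rightarrow> ('o set, 'm set, 'o set, 'm list set) func" where
  "canonical_functor C \<Phi> = (THE T.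
    cat_functor (riguet_quotient C \<Phi>) (gcong_quotient C (natural_gcong C \<Phi>)) T \<and>
    func_comp C T (riguet_proj C \<Phi>) = gcong_proj C (natural_gcong C \<Phi>))"

section \<open>Compatible choice functions\<close>

definition hom_choice :: "('o, 'm) cat \<Rightarrow> ('o, 'm) riguet \<Rightarrow> ('o \<Rightarrow> 'o \<Rightarrow> 'm) \<Rightarrow> bool" where
  "hom_choice C \<Phi> F \<longleftrightarrow> (\<forall>(a, b) \<in> rob \<Phi>. F a b \<in> Hom C a b)"

definition compatible_choice :: "('o, 'm) cat \<Rightarrow> ('o, 'm) riguet \<Rightarrow> ('o \<Rightarrow> 'o \<Rightarrow> 'm) \<Rightarrow> bool" where
  "compatible_choice C \<Phi> F \<longleftrightarrow>
    (\<forall>a \<in> Ob C. F a a = idm C a) \<and>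
    (\<forall>a b a' b'. (a, a') \<in> rob \<Phi> \<and> (b, b') \<in> rob \<Phi> \<and> (a, b) \<in> rob \<Phi> \<and> (a', b') \<in> rob \<Phi>
      \<longrightarrow> (F a b, F a' b') \<in> rfl \<Phi> a b a' b')"

end

theory Submission
  imports Defs
begin

text \<open>
  The canonical functor is in fact an isomorphism of categories: both quotients are the image of
  \<open>C\<close> under the projection \<open>P\<close> to the Riguet quotient \<open>Q\<close>, described in two ways.

  Any functor \<open>T: C \<rightarrow> D\<close> has a kernel, a generalized congruence: objects are identified when \<open>T\<close>
  identifies them, so the \<open>T\<close>-images of a sequence of morphisms that is composable up to this relation
  are composable in \<open>D\<close>, and sequences are identified when these composites agree
  (\<open>kernel_congruence\<close>). If \<open>T\<close> is surjective on objects and on morphisms, then sending an object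
  or a morphism of \<open>D\<close> to its fibre is an isomorphism from \<open>D\<close> to the quotient of \<open>C\<close> by the
  kernel (\<open>fibre_equivalence\<close>), and it is the only functor that turns \<open>T\<close> into the projection
  to that quotient (\<open>fibre_factors\<close>, \<open>factor_unique\<close>).

  The projection \<open>P\<close> is such a functor, so it remains to see that its kernel is the least generalized
  congruence above \<open>\<Phi>\<close> (\<open>natural_gcong_kernel\<close>). The point is that by (Rf) every \<open>f\<close> whose target
  is only equivalent to the source of \<open>g\<close> is \<open>\<Phi>\<close>-related to some \<open>h\<close> that ends exactly there. Any
  generalized congruence above \<open>\<Phi>\<close> therefore identifies \<open>(f, g)\<close> with \<open>(h, g)\<close> and so with the
  single morphism \<open>g \<circ> h\<close>, whose class is \<open>[g] \<circ> [f]\<close> in \<open>Q\<close>. Inductively every sequence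
  collapses to one morphism that represents its composite in \<open>Q\<close> (\<open>path_reduces\<close>). Two sequences
  with the same composite collapse to \<open>\<Phi>\<close>-related morphisms, hence are identified by every
  generalized congruence above \<open>\<Phi>\<close>.
\<close>

section \<open>Sources, targets and composable sequences\<close>

context category
begin

lemma Mor_iff: "f \<in> Mor C \<longleftrightarrow> (\<exists>a \<in> Ob C. \<exists>b \<in> Ob C. f \<in> Hom C a b)"
  by (auto simp: Mor_def)

lemma hom_unique:
  assumes "f \<in> Hom C a b" "f \<in> Hom C a' b'" "a \<in> Ob C" "b \<in> Ob C" "a' \<in> Ob C" "b' \<in> Ob C"
  shows "a = a' \<and> b = b'"
  using hom_disjoint[of a b a' b'] assms by blast

lemma sc_eq: "\<lbrakk>f \<in> Hom C a b; a \<in> Ob C; b \<in> Ob C\<rbrakk> \<Longrightarrow> sc C f = a"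
  unfolding sc_def by (rule the_equality) (use hom_unique in blast)+

lemma tg_eq: "\<lbrakk>f \<in> Hom C a b; a \<in> Ob C; b \<in> Ob C\<rbrakk> \<Longrightarrow> tg C f = b"
  unfolding tg_def by (rule the_equality) (use hom_unique in blast)+

lemma Mor_hom: "f \<in> Mor C \<Longrightarrow> f \<in> Hom C (sc C f) (tg C f)"
  by (auto simp: Mor_iff sc_eq tg_eq)

lemma sc_ob: "f \<in> Mor C \<Longrightarrow> sc C f \<in> Ob C"
  by (auto simp: Mor_iff sc_eq)

lemma tg_ob: "f \<in> Mor C \<Longrightarrow> tg C f \<in> Ob C"
  by (auto simp: Mor_iff tg_eq)

lemma hom_Mor: "\<lbrakk>f \<in> Hom C a b; a \<in> Ob C; b \<in> Ob C\<rbrakk> \<Longrightarrow> f \<in> Mor C"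
  by (auto simp: Mor_iff)

lemma id_Mor: "a \<in> Ob C \<Longrightarrow> idm C a \<in> Mor C"
  using id_hom hom_Mor by blast

lemma sc_id: "a \<in> Ob C \<Longrightarrow> sc C (idm C a) = a"
  and tg_id: "a \<in> Ob C \<Longrightarrow> tg C (idm C a) = a"
  using id_hom sc_eq tg_eq by blast+

lemma cmp_hom': "\<lbrakk>f \<in> Mor C; g \<in> Mor C; tg C f = sc C g\<rbrakk> \<Longrightarrow> cmp C g f \<in> Hom C (sc C f) (tg C g)"
  using cmp_hom[of "sc C f" "tg C f" "tg C g" f g] Mor_hom[of f] Mor_hom[of g] sc_ob tg_ob by auto

lemma
  assumes "f \<in> Mor C" "g \<in> Mor C" "tg C f = sc C g"
  shows cmp_Mor: "cmp C g f \<in> Mor C"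
    and sc_cmp: "sc C (cmp C g f) = sc C f"
    and tg_cmp: "tg C (cmp C g f) = tg C g"
  using cmp_hom'[OF assms] assms sc_ob tg_ob hom_Mor sc_eq tg_eq by blast+

end

lemma Mor_plus_singleton [simp]: "[f] \<in> Mor_plus C E \<longleftrightarrow> f \<in> Mor C"
  by (auto simp: Mor_plus_def)

lemma Mor_plus_Cons:
  assumes "v \<noteq> []"
  shows "f # v \<in> Mor_plus C E \<longleftrightarrow>
    f \<in> Mor C \<and> v \<in> Mor_plus C E \<and> (tg C f, sc C (hd v)) \<in> E"
proof -
  have "(\<forall>i. Suc i < length (f # v) \<longrightarrow> (tg C ((f # v) ! i), sc C ((f # v) ! Suc i)) \<in> E) \<longleftrightarrow>
    (tg C f, sc C (hd v)) \<in> E \<and>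
    (\<forall>i. Suc i < length v \<longrightarrow> (tg C (v ! i), sc C (v ! Suc i)) \<in> E)" (is "?L \<longleftrightarrow> ?R")
  proof
    assume L: ?L
    show ?R
      using L[rule_format, of 0] L[rule_format, of "Suc _"] assms by (auto simp: hd_conv_nth)
  next
    assume R: ?R
    show ?L
    proof (intro allI impI)
      fix i assume "Suc i < length (f # v)"
      then show "(tg C ((f # v) ! i), sc C ((f # v) ! Suc i)) \<in> E"
        using R assms by (cases i) (auto simp: hd_conv_nth)
    qed
  qed
  then show ?thesis
    using assms by (auto simp: Mor_plus_def)
qed

lemma Mor_plus_nonempty: "u \<in> Mor_plus C E \<Longrightarrow> u \<noteq> []"
  by (auto simp: Mor_plus_def)

lemma Mor_plus_append:
  assumes "u \<noteq> []" "v \<noteq> []"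
  shows "u @ v \<in> Mor_plus C E \<longleftrightarrow>
    u \<in> Mor_plus C E \<and> v \<in> Mor_plus C E \<and> (tg C (last u), sc C (hd v)) \<in> E"
  using assms(1)
proof (induction u rule: list_nonempty_induct)
  case (single f)
  then show ?case by (simp add: Mor_plus_Cons assms)
next
  case (cons f u)
  then show ?case by (auto simp: Mor_plus_Cons)
qed

lemma Mor_plus_ends: "u \<in> Mor_plus C E \<Longrightarrow> hd u \<in> Mor C \<and> last u \<in> Mor C"
  by (auto simp: Mor_plus_def)

lemma Mor_plus_induct [consumes 1, case_names single Cons]:
  assumes "u \<in> Mor_plus C E"
    and "\<And>f. f \<in> Mor C \<Longrightarrow> P [f]"
    and "\<And>f v. \<lbrakk>f \<in> Mor C; v \<in> Mor_plus C E; (tg C f, sc C (hd v)) \<in> E; P v\<rbrakk> \<Longrightarrow> P (f # v)"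
  shows "P u"
proof -
  have "u \<noteq> []" using assms(1) by (rule Mor_plus_nonempty)
  then show ?thesis using assms(1)
    by (induction u rule: list_nonempty_induct) (auto simp: Mor_plus_Cons assms(2,3))
qed

section \<open>Isomorphisms of categories are equivalences\<close>

lemma (in category) iso_in_id: "a \<in> Ob C \<Longrightarrow> iso_in C a a (idm C a)"
  unfolding iso_in_def using id_hom id_left by blast

lemma (in category) naturally_isomorphic_id:
  assumes "S = func_id C"
  shows "naturally_isomorphic C C S (func_id C)"
proof -
  have "cmp C (idm C b) f = cmp C f (idm C a)" if "a \<in> Ob C" "b \<in> Ob C" "f \<in> Hom C a b" for a b f
    using that by (simp add: id_left id_right)
  then show ?thesis
    unfolding assms naturally_isomorphic_def
    by (intro exI[of _ "idm C"]) (auto simp: func_id_def iso_in_id hom_Mor)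
qed

lemma (in cat_functor) onmor_Mor: "f \<in> Mor C \<Longrightarrow> onmor T f \<in> Mor D"
  using mor_map ob_map source.Mor_iff target.Mor_iff by meson

lemma (in cat_functor)
  assumes "f \<in> Mor C"
  shows sc_map: "sc D (onmor T f) = onob T (sc C f)"
    and tg_map: "tg D (onmor T f) = onob T (tg C f)"
proof -
  have "onmor T f \<in> Hom D (onob T (sc C f)) (onob T (tg C f))"
    using assms mor_map source.Mor_hom source.sc_ob source.tg_ob by blast
  then show "sc D (onmor T f) = onob T (sc C f)" "tg D (onmor T f) = onob T (tg C f)"
    using assms target.sc_eq target.tg_eq ob_map source.sc_ob source.tg_ob by blast+
qed

lemma (in cat_functor) map_cmp':
  assumes "f \<in> Mor C" "g \<in> Mor C" "tg C f = sc C g"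
  shows "onmor T (cmp C g f) = cmp D (onmor T g) (onmor T f)"
  using map_cmp[of "sc C f" "tg C f" "tg C g" f g] assms source.Mor_hom[of f] source.Mor_hom[of g]
    source.sc_ob source.tg_ob by auto

text \<open>
  The inverse maps form a functor: a preimage of a morphism \<open>A \<rightarrow> B\<close> has the preimages of \<open>A\<close> and
  \<open>B\<close> as its ends because hom-sets are disjoint. Both composites are then identity functors on
  the nose, so identities serve as the natural isomorphisms.
\<close>

lemma (in cat_functor) bijective_equivalence:
  assumes ob: "bij_betw (onob T) (Ob C) (Ob D)"
    and mor: "bij_betw (onmor T) (Mor C) (Mor D)"
  shows "equivalence_functor C D T"
proof -
  define U where "U = \<lparr>onob = (\<lambda>A \<in> Ob D. inv_into (Ob C) (onob T) A),
    onmor = (\<lambda>X \<in> Mor D. inv_into (Mor C) (onmor T) X)\<rparr>"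
  have Uob: "onob U (onob T a) = a" if "a \<in> Ob C" for a
    using that ob ob_map by (simp add: U_def bij_betw_inv_into_left)
  have Umor: "onmor U (onmor T f) = f" if "f \<in> Mor C" for f
    using that mor onmor_Mor by (simp add: U_def bij_betw_inv_into_left)
  have obE: "\<exists>a \<in> Ob C. A = onob T a" if "A \<in> Ob D" for A
    using that ob by (auto simp: bij_betw_def)
  have homE: "\<exists>f \<in> Hom C (onob U A) (onob U B). X = onmor T f"
    if "A \<in> Ob D" "B \<in> Ob D" "X \<in> Hom D A B" for A B X
  proof -
    have "X \<in> Mor D" using that target.hom_Mor by blast
    then obtain f where f: "f \<in> Mor C" "X = onmor T f"
      using mor by (auto simp: bij_betw_def)
    have "A = onob T (sc C f)" "B = onob T (tg C f)"
      using f sc_map tg_map that target.sc_eq target.tg_eq by metis+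
    then show ?thesis
      using f Uob source.sc_ob source.tg_ob source.Mor_hom by auto
  qed
  have Uob_in: "onob U A \<in> Ob C" if "A \<in> Ob D" for A
    using obE[OF that] Uob by auto
  have U: "cat_functor D C U"
  proof
    show "onob U \<in> extensional (Ob D)" "onmor U \<in> extensional (Mor D)"
      by (auto simp: U_def)
    fix A assume A: "A \<in> Ob D"
    show "onob U A \<in> Ob C" by (rule Uob_in[OF A])
    show "onmor U (idm D A) = idm C (onob U A)"
      using obE[OF A] map_id Uob Umor source.id_Mor by metis
  next
    fix A B X assume AB: "A \<in> Ob D" "B \<in> Ob D" "X \<in> Hom D A B"
    show "onmor U X \<in> Hom C (onob U A) (onob U B)"
      using homE[OF AB] Umor source.hom_Mor Uob_in AB by metis
  next
    fix A B E X Y assume *: "A \<in> Ob D" "B \<in> Ob D" "E \<in> Ob D" "X \<in> Hom D A B" "Y \<in> Hom D B E"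
    obtain f where f: "f \<in> Hom C (onob U A) (onob U B)" "X = onmor T f" using homE * by blast
    obtain g where g: "g \<in> Hom C (onob U B) (onob U E)" "Y = onmor T g" using homE * by blast
    have "cmp D Y X = onmor T (cmp C g f)"
      using f g map_cmp[OF Uob_in[OF *(1)] Uob_in[OF *(2)] Uob_in[OF *(3)] f(1) g(1)] by simp
    moreover have "f \<in> Mor C" "g \<in> Mor C" "cmp C g f \<in> Mor C"
      using f g Uob_in * source.cmp_hom source.hom_Mor by meson+
    ultimately show "onmor U (cmp D Y X) = cmp C (onmor U Y) (onmor U X)"
      using f g Umor by simp
  qed
  have TU_ob: "onob T (onob U A) = A" if "A \<in> Ob D" for A
    using obE[OF that] Uob by auto
  have TU_mor: "onmor T (onmor U X) = X" if "X \<in> Mor D" for X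
    using that mor by (simp add: U_def bij_betw_inv_into_right)
  have "func_comp C U T = func_id C" "func_comp D T U = func_id D"
    by (auto simp: func_comp_def func_id_def compose_def Uob Umor TU_ob TU_mor cong: restrict_cong)
  then show ?thesis
    unfolding equivalence_functor_def
    using U cat_functor_axioms source.naturally_isomorphic_id target.naturally_isomorphic_id by blast
qed

section \<open>The quotient by a generalized congruence\<close>

context generalized_congruence
begin

lemma gfl_refl: "u \<in> Mor_plus C (gob \<Psi>) \<Longrightarrow> (u, u) \<in> gfl \<Psi>"
  using gfl_equiv by (auto simp: equiv_def refl_on_def)

lemma gfl_sym: "(u, v) \<in> gfl \<Psi> \<Longrightarrow> (v, u) \<in> gfl \<Psi>"
  using gfl_equiv by (auto simp: equiv_def sym_def)

lemma gfl_trans: "\<lbrakk>(u, v) \<in> gfl \<Psi>; (v, w) \<in> gfl \<Psi>\<rbrakk> \<Longrightarrow> (u, w) \<in> gfl \<Psi>"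
  using gfl_equiv unfolding equiv_def by (blast dest: transD)

lemma gfl_class_eq: "(u, v) \<in> gfl \<Psi> \<Longrightarrow> gfl \<Psi> `` {u} = gfl \<Psi> `` {v}"
  using gfl_equiv by (rule equiv_class_eq)

lemma gob_sub: "(a, b) \<in> gob \<Psi> \<Longrightarrow> a \<in> Ob C \<and> b \<in> Ob C"
  using gob_equiv by (auto simp: equiv_def refl_on_def)

lemma gob_refl: "a \<in> Ob C \<Longrightarrow> (a, a) \<in> gob \<Psi>"
  using gob_equiv by (auto simp: equiv_def refl_on_def)

lemma gob_sym: "(a, b) \<in> gob \<Psi> \<Longrightarrow> (b, a) \<in> gob \<Psi>"
  using gob_equiv by (auto simp: equiv_def sym_def)

lemma gob_trans: "\<lbrakk>(a, b) \<in> gob \<Psi>; (b, c) \<in> gob \<Psi>\<rbrakk> \<Longrightarrow> (a, c) \<in> gob \<Psi>"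
  using gob_equiv unfolding equiv_def by (blast dest: transD)

lemma class_member: "\<lbrakk>A \<in> Ob C // gob \<Psi>; a \<in> A\<rbrakk> \<Longrightarrow> a \<in> Ob C \<and> A = gob \<Psi> `` {a}"
proof -
  assume A: "A \<in> Ob C // gob \<Psi>" and a: "a \<in> A"
  obtain x where x: "A = gob \<Psi> `` {x}" using A by (rule quotientE)
  then have xa: "(x, a) \<in> gob \<Psi>" using a by simp
  then show "a \<in> Ob C \<and> A = gob \<Psi> `` {a}"
    using gob_sub[OF xa] equiv_class_eq[OF gob_equiv xa] x by simp
qed

lemma classes_disjoint:
  assumes "A \<in> Ob C // gob \<Psi>" "B \<in> Ob C // gob \<Psi>" "a \<in> A" "b \<in> B" "(a, b) \<in> gob \<Psi>"
  shows "A = B"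
  using class_member[OF assms(1,3)] class_member[OF assms(2,4)] equiv_class_eq[OF gob_equiv assms(5)]
  by simp

lemma same_class: "\<lbrakk>A \<in> Ob C // gob \<Psi>; a \<in> A; b \<in> A\<rbrakk> \<Longrightarrow> (a, b) \<in> gob \<Psi>"
  using class_member[of A a] by blast

lemma quotient_Ob [simp]: "Ob (gcong_quotient C \<Psi>) = Ob C // gob \<Psi>"
  by (simp add: gcong_quotient_def)

lemma quotient_Hom: "X \<in> Hom (gcong_quotient C \<Psi>) A B \<longleftrightarrow>
    (\<exists>u \<in> Mor_plus C (gob \<Psi>). X = gfl \<Psi> `` {u} \<and> sc C (hd u) \<in> A \<and> tg C (last u) \<in> B)"
  by (auto simp: gcong_quotient_def)

lemma quotient_id:
  assumes "(a, b) \<in> gob \<Psi>"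
  shows "idm (gcong_quotient C \<Psi>) (gob \<Psi> `` {a}) = gfl \<Psi> `` {[idm C b]}"
proof -
  have "gfl \<Psi> `` {[idm C c]} = gfl \<Psi> `` {[idm C b]}" if "(a, c) \<in> gob \<Psi>" for c
    by (rule gfl_class_eq[OF Ga[OF gob_trans[OF gob_sym[OF that] assms]]])
  then have "(\<Union>c \<in> gob \<Psi> `` {a}. gfl \<Psi> `` {[idm C c]}) =
      (\<Union>c \<in> gob \<Psi> `` {a}. gfl \<Psi> `` {[idm C b]})"
    by (intro SUP_cong refl) simp
  moreover have "gob \<Psi> `` {a} \<noteq> {}" using assms by blast
  ultimately show ?thesis
    by (simp add: gcong_quotient_def)
qed

lemma quotient_cmp:
  assumes "u \<in> Mor_plus C (gob \<Psi>)" "v \<in> Mor_plus C (gob \<Psi>)" "(tg C (last u), sc C (hd v)) \<in> gob \<Psi>"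
  shows "cmp (gcong_quotient C \<Psi>) (gfl \<Psi> `` {v}) (gfl \<Psi> `` {u}) = gfl \<Psi> `` {u @ v}"
proof -
  have "gfl \<Psi> `` {u' @ v'} = gfl \<Psi> `` {u @ v}" if "(u, u') \<in> gfl \<Psi>" "(v, v') \<in> gfl \<Psi>" for u' v'
    using Gd[OF that assms(3)] gfl_class_eq by auto
  then have "(\<Union>v' \<in> gfl \<Psi> `` {v}. \<Union>u' \<in> gfl \<Psi> `` {u}. gfl \<Psi> `` {u' @ v'}) =
      (\<Union>v' \<in> gfl \<Psi> `` {v}. \<Union>u' \<in> gfl \<Psi> `` {u}. gfl \<Psi> `` {u @ v})"
    by (intro SUP_cong refl) simp
  moreover have "gfl \<Psi> `` {u} \<noteq> {}" "gfl \<Psi> `` {v} \<noteq> {}"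
    using assms gfl_refl by blast+
  ultimately show ?thesis
    by (simp add: gcong_quotient_def)
qed

text \<open>
  Clause (c) only absorbs an identity into a single neighbouring morphism; clause (d) extends this to
  the rest of the sequence. This lemma and its mirror image are the unit laws of the quotient.
\<close>

lemma id_absorb_left:
  assumes "u \<in> Mor_plus C (gob \<Psi>)"
  shows "(idm C (sc C (hd u)) # u, u) \<in> gfl \<Psi>"
proof -
  obtain f v where u: "u = f # v" using assms Mor_plus_nonempty by (cases u) auto
  have f: "f \<in> Mor C" using Mor_plus_ends[OF assms] u by simp
  have 1: "([idm C (sc C f), f], [f]) \<in> gfl \<Psi>"
    using Gc[of "idm C (sc C f)" f] f by (simp add: id_Mor tg_id sc_ob id_right[OF _ _ Mor_hom] tg_ob)
  show ?thesis
  proof (cases "v = []")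
    case True then show ?thesis using 1 u by simp
  next
    case False
    then have "v \<in> Mor_plus C (gob \<Psi>)" "(tg C f, sc C (hd v)) \<in> gob \<Psi>"
      using assms u by (auto simp: Mor_plus_Cons)
    then show ?thesis using Gd[OF 1 gfl_refl] u by simp
  qed
qed

lemma id_absorb_right:
  assumes "u \<in> Mor_plus C (gob \<Psi>)"
  shows "(u @ [idm C (tg C (last u))], u) \<in> gfl \<Psi>"
proof -
  obtain f v where u: "u = v @ [f]" using assms Mor_plus_nonempty by (cases u rule: rev_cases) auto
  have f: "f \<in> Mor C" using Mor_plus_ends[OF assms] u by simp
  have 1: "([f, idm C (tg C f)], [f]) \<in> gfl \<Psi>"
    using Gc[of f "idm C (tg C f)"] f by (simp add: id_Mor sc_id tg_ob id_left[OF _ _ Mor_hom] sc_ob)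
  show ?thesis
  proof (cases "v = []")
    case True then show ?thesis using 1 u by simp
  next
    case False
    then have "v \<in> Mor_plus C (gob \<Psi>)" "(tg C (last v), sc C f) \<in> gob \<Psi>"
      using assms u by (auto simp: Mor_plus_append)
    then show ?thesis using Gd[OF gfl_refl 1] u by simp
  qed
qed

lemma quotient_category: "category (gcong_quotient C \<Psi>)" (is "category ?Q")
proof
  fix A B A' B'
  assume A: "A \<in> Ob ?Q" "B \<in> Ob ?Q" "A' \<in> Ob ?Q" "B' \<in> Ob ?Q" and ne: "(A, B) \<noteq> (A', B')"
  show "Hom ?Q A B \<inter> Hom ?Q A' B' = {}"
  proof (rule ccontr)
    assume "Hom ?Q A B \<inter> Hom ?Q A' B' \<noteq> {}"
    then obtain u v where u: "u \<in> Mor_plus C (gob \<Psi>)" "sc C (hd u) \<in> A" "tg C (last u) \<in> B"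
      and v: "v \<in> Mor_plus C (gob \<Psi>)" "sc C (hd v) \<in> A'" "tg C (last v) \<in> B'"
      and eq: "gfl \<Psi> `` {u} = gfl \<Psi> `` {v}"
      by (auto simp: quotient_Hom)
    have "(u, v) \<in> gfl \<Psi>" using eq gfl_refl[OF v(1)] by auto
    then show False using Gb classes_disjoint A ne u v by (metis quotient_Ob)
  qed
next
  fix A assume "A \<in> Ob ?Q"
  then obtain a where a: "a \<in> Ob C" "A = gob \<Psi> `` {a}" by (auto elim: quotientE)
  show "idm ?Q A \<in> Hom ?Q A A"
    unfolding quotient_Hom using a gob_refl[of a]
    by (intro bexI[of _ "[idm C a]"]) (auto simp: quotient_id sc_id tg_id id_Mor)
next
  fix A B E X Y
  assume "A \<in> Ob ?Q" and B: "B \<in> Ob ?Q" and "E \<in> Ob ?Q" "X \<in> Hom ?Q A B" "Y \<in> Hom ?Q B E"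
  then obtain u v where u: "u \<in> Mor_plus C (gob \<Psi>)" "sc C (hd u) \<in> A" "tg C (last u) \<in> B" "X = gfl \<Psi> `` {u}"
    and v: "v \<in> Mor_plus C (gob \<Psi>)" "sc C (hd v) \<in> B" "tg C (last v) \<in> E" "Y = gfl \<Psi> `` {v}"
    by (auto simp: quotient_Hom)
  have "(tg C (last u), sc C (hd v)) \<in> gob \<Psi>" using B u v same_class by simp
  then show "cmp ?Q Y X \<in> Hom ?Q A E"
    unfolding quotient_Hom using u v Mor_plus_nonempty[OF u(1)] Mor_plus_nonempty[OF v(1)]
    by (intro bexI[of _ "u @ v"]) (auto simp: quotient_cmp Mor_plus_append)
next
  fix A B X
  assume A: "A \<in> Ob ?Q" and B: "B \<in> Ob ?Q" and "X \<in> Hom ?Q A B"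
  then obtain u where u: "u \<in> Mor_plus C (gob \<Psi>)" "sc C (hd u) \<in> A" "tg C (last u) \<in> B" "X = gfl \<Psi> `` {u}"
    by (auto simp: quotient_Hom)
  let ?a = "sc C (hd u)" and ?b = "tg C (last u)"
  have ab: "?a \<in> Ob C" "?b \<in> Ob C" using Mor_plus_ends[OF u(1)] sc_ob tg_ob by auto
  have "idm ?Q A = gfl \<Psi> `` {[idm C ?a]}"
    using class_member[of A ?a] A u quotient_id[OF gob_refl] by auto
  then have "cmp ?Q X (idm ?Q A) = gfl \<Psi> `` {[idm C ?a] @ u}"
    using u ab gob_refl by (simp add: quotient_cmp id_Mor tg_id)
  then show "cmp ?Q X (idm ?Q A) = X"
    using id_absorb_left[OF u(1)] gfl_class_eq u by auto
  have "idm ?Q B = gfl \<Psi> `` {[idm C ?b]}"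
    using class_member[of B ?b] B u quotient_id[OF gob_refl] by auto
  then have "cmp ?Q (idm ?Q B) X = gfl \<Psi> `` {u @ [idm C ?b]}"
    using u ab gob_refl by (simp add: quotient_cmp id_Mor sc_id)
  then show "cmp ?Q (idm ?Q B) X = X"
    using id_absorb_right[OF u(1)] gfl_class_eq u by auto
next
  fix A B E G X Y Z
  assume "A \<in> Ob ?Q" and B: "B \<in> Ob ?Q" and E: "E \<in> Ob ?Q" and "G \<in> Ob ?Q"
    and "X \<in> Hom ?Q A B" "Y \<in> Hom ?Q B E" "Z \<in> Hom ?Q E G"
  then obtain u v w where u: "u \<in> Mor_plus C (gob \<Psi>)" "tg C (last u) \<in> B" "X = gfl \<Psi> `` {u}"
    and v: "v \<in> Mor_plus C (gob \<Psi>)" "sc C (hd v) \<in> B" "tg C (last v) \<in> E" "Y = gfl \<Psi> `` {v}"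
    and w: "w \<in> Mor_plus C (gob \<Psi>)" "sc C (hd w) \<in> E" "Z = gfl \<Psi> `` {w}"
    by (auto simp: quotient_Hom)
  have uv: "(tg C (last u), sc C (hd v)) \<in> gob \<Psi>" and vw: "(tg C (last v), sc C (hd w)) \<in> gob \<Psi>"
    using B E u v w same_class by auto
  note ne = Mor_plus_nonempty[OF u(1)] Mor_plus_nonempty[OF v(1)] Mor_plus_nonempty[OF w(1)]
  have YX: "cmp ?Q Y X = gfl \<Psi> `` {u @ v}" and ZY: "cmp ?Q Z Y = gfl \<Psi> `` {v @ w}"
    unfolding u(3) v(4) w(3) by (rule quotient_cmp[OF u(1) v(1) uv] quotient_cmp[OF v(1) w(1) vw])+
  have M: "u @ v \<in> Mor_plus C (gob \<Psi>)" "v @ w \<in> Mor_plus C (gob \<Psi>)"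
    using u(1) v(1) w(1) uv vw ne by (simp_all add: Mor_plus_append)
  have "cmp ?Q Z (cmp ?Q Y X) = gfl \<Psi> `` {(u @ v) @ w}"
    unfolding YX w(3) using vw ne by (intro quotient_cmp M w(1)) simp
  moreover have "cmp ?Q (cmp ?Q Z Y) X = gfl \<Psi> `` {u @ (v @ w)}"
    unfolding ZY u(3) using uv ne by (intro quotient_cmp M u(1)) simp
  ultimately show "cmp ?Q Z (cmp ?Q Y X) = cmp ?Q (cmp ?Q Z Y) X" by simp
qed

end

section \<open>The kernel of a functor\<close>

text \<open>
  The composite in \<open>D\<close> of the images of a sequence. Sequences are listed in the order in which the
  morphisms are applied, so the first entry ends up innermost.
\<close>

fun path_val :: "('p, 'n) cat \<Rightarrow> ('o, 'm, 'p, 'n) func \<Rightarrow> 'm list \<Rightarrow> 'n" where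
  "path_val D T [f] = onmor T f"
| "path_val D T (f # g # u) = cmp D (path_val D T (g # u)) (onmor T f)"

definition kernel_ob :: "('o, 'm) cat \<Rightarrow> ('o, 'm, 'p, 'n) func \<Rightarrow> ('o \<times> 'o) set" where
  "kernel_ob C T = {(a, b). a \<in> Ob C \<and> b \<in> Ob C \<and> onob T a = onob T b}"

definition functor_kernel :: "('o, 'm) cat \<Rightarrow> ('p, 'n) cat \<Rightarrow> ('o, 'm, 'p, 'n) func \<Rightarrow> ('o, 'm) gcong" where
  "functor_kernel C D T = \<lparr>gob = kernel_ob C T,
    gfl = {(u, v). u \<in> Mor_plus C (kernel_ob C T) \<and> v \<in> Mor_plus C (kernel_ob C T) \<and>
      path_val D T u = path_val D T v}\<rparr>"

text \<open>
  Since the kernel classes are exactly the nonempty fibres of the object map and of \<open>path_val\<close>, the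
  comparison from \<open>D\<close> to the quotient by the kernel can be written without choosing preimages.
\<close>

definition fibre_functor :: "('o, 'm) cat \<Rightarrow> ('p, 'n) cat \<Rightarrow> ('o, 'm, 'p, 'n) func \<Rightarrow>
    ('p, 'n, 'o set, 'm list set) func" where
  "fibre_functor C D T = \<lparr>onob = (\<lambda>A \<in> Ob D. {a \<in> Ob C. onob T a = A}),
    onmor = (\<lambda>X \<in> Mor D. {u \<in> Mor_plus C (kernel_ob C T). path_val D T u = X})\<rparr>"

lemma kernel_simps [simp]:
  "gob (functor_kernel C D T) = kernel_ob C T"
  "(u, v) \<in> gfl (functor_kernel C D T) \<longleftrightarrow> u \<in> Mor_plus C (kernel_ob C T) \<and>
    v \<in> Mor_plus C (kernel_ob C T) \<and> path_val D T u = path_val D T v"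
  by (auto simp: functor_kernel_def)

lemma path_val_Cons: "v \<noteq> [] \<Longrightarrow> path_val D T (f # v) = cmp D (path_val D T v) (onmor T f)"
  by (cases v) auto

context cat_functor
begin

lemma path_val_ends:
  assumes "u \<in> Mor_plus C (kernel_ob C T)"
  shows "path_val D T u \<in> Mor D \<and> sc D (path_val D T u) = onob T (sc C (hd u)) \<and>
    tg D (path_val D T u) = onob T (tg C (last u))"
  using assms
proof (induction rule: Mor_plus_induct)
  case (single f)
  then show ?case by (simp add: onmor_Mor sc_map tg_map)
next
  case (Cons f v)
  have "tg D (onmor T f) = sc D (path_val D T v)"
    using Cons by (auto simp: tg_map kernel_ob_def)
  then show ?case
    using Cons Mor_plus_nonempty[OF Cons(2)]
    by (auto simp: path_val_Cons onmor_Mor sc_map tg_map target.cmp_Mor target.sc_cmp target.tg_cmp)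
qed

text \<open>
  This is what makes the kernel compatible with concatenation, as clause (d) demands.
\<close>

lemma path_val_append:
  assumes "u \<in> Mor_plus C (kernel_ob C T)" "v \<in> Mor_plus C (kernel_ob C T)"
    "onob T (tg C (last u)) = onob T (sc C (hd v))"
  shows "path_val D T (u @ v) = cmp D (path_val D T v) (path_val D T u)"
  using assms(1,3)
proof (induction rule: Mor_plus_induct)
  case (single f)
  then show ?case using Mor_plus_nonempty[OF assms(2)] by (simp add: path_val_Cons)
next
  case (Cons f w)
  have w: "w \<noteq> []" using Mor_plus_nonempty[OF Cons(2)] .
  have f: "onmor T f \<in> Hom D (sc D (onmor T f)) (onob T (sc C (hd w)))" "sc D (onmor T f) \<in> Ob D"
    using target.Mor_hom[OF onmor_Mor[OF Cons(1)]] Cons(3) target.sc_ob[OF onmor_Mor[OF Cons(1)]]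
    by (auto simp: tg_map[OF Cons(1)] kernel_ob_def)
  note W = path_val_ends[OF Cons(2)] and V = path_val_ends[OF assms(2)]
  have wh: "path_val D T w \<in> Hom D (onob T (sc C (hd w))) (onob T (tg C (last w)))"
    "path_val D T v \<in> Hom D (onob T (sc C (hd v))) (onob T (tg C (last v)))"
    "onob T (sc C (hd w)) \<in> Ob D" "onob T (tg C (last w)) \<in> Ob D" "onob T (tg C (last v)) \<in> Ob D"
    using W V target.Mor_hom target.sc_ob target.tg_ob by metis+
  have "cmp D (path_val D T v) (cmp D (path_val D T w) (onmor T f)) =
      cmp D (cmp D (path_val D T v) (path_val D T w)) (onmor T f)"
    using f wh w Cons(5) by (intro target.cmp_assoc[OF f(2) wh(3) wh(4) wh(5) f(1) wh(1)]) simp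
  then show ?case
    using Cons w by (simp add: path_val_Cons)
qed

lemma kernel_ob_equiv: "equiv (Ob C) (kernel_ob C T)"
  by (auto simp: equiv_def refl_on_def sym_def trans_def kernel_ob_def)

lemma kernel_congruence: "generalized_congruence C (functor_kernel C D T)"
proof
  show "equiv (Ob C) (gob (functor_kernel C D T))"
    using kernel_ob_equiv by simp
  show "equiv (Mor_plus C (gob (functor_kernel C D T))) (gfl (functor_kernel C D T))"
    by (auto simp: equiv_def refl_on_def sym_def trans_def)
next
  fix a b assume "(a, b) \<in> gob (functor_kernel C D T)"
  then show "([idm C a], [idm C b]) \<in> gfl (functor_kernel C D T)"
    by (auto simp: kernel_ob_def source.id_Mor map_id)
next
  fix u v assume "(u, v) \<in> gfl (functor_kernel C D T)"
  then have uv: "u \<in> Mor_plus C (kernel_ob C T)" "v \<in> Mor_plus C (kernel_ob C T)"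
    "path_val D T u = path_val D T v" by auto
  have "onob T (sc C (hd u)) = onob T (sc C (hd v))" "onob T (tg C (last u)) = onob T (tg C (last v))"
    using path_val_ends[OF uv(1)] path_val_ends[OF uv(2)] uv(3) by auto
  then show "(sc C (hd u), sc C (hd v)) \<in> gob (functor_kernel C D T) \<and>
      (tg C (last u), tg C (last v)) \<in> gob (functor_kernel C D T)"
    using Mor_plus_ends[OF uv(1)] Mor_plus_ends[OF uv(2)] source.sc_ob source.tg_ob
    by (auto simp: kernel_ob_def)
next
  fix f g assume "f \<in> Mor C" "g \<in> Mor C" "sc C g = tg C f"
  then show "([f, g], [cmp C g f]) \<in> gfl (functor_kernel C D T)"
    using source.tg_ob[of f] by (auto simp: Mor_plus_Cons kernel_ob_def map_cmp' source.cmp_Mor)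
next
  fix u u' v v'
  assume uu: "(u, u') \<in> gfl (functor_kernel C D T)" and vv: "(v, v') \<in> gfl (functor_kernel C D T)"
    and uv: "(tg C (last u), sc C (hd v)) \<in> gob (functor_kernel C D T)"
  have M: "u \<in> Mor_plus C (kernel_ob C T)" "u' \<in> Mor_plus C (kernel_ob C T)"
    "v \<in> Mor_plus C (kernel_ob C T)" "v' \<in> Mor_plus C (kernel_ob C T)"
    and eq: "path_val D T u = path_val D T u'" "path_val D T v = path_val D T v'"
    using uu vv by auto
  have "onob T (tg C (last u)) = onob T (sc C (hd v))"
    using uv by (simp add: kernel_ob_def)
  moreover have "onob T (tg C (last u')) = onob T (sc C (hd v'))"
    using calculation path_val_ends[OF M(1)] path_val_ends[OF M(2)] path_val_ends[OF M(3)]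
      path_val_ends[OF M(4)] eq by simp
  moreover have "tg C (last u') \<in> Ob C" "sc C (hd v') \<in> Ob C"
    using Mor_plus_ends M source.sc_ob source.tg_ob by blast+
  ultimately show "(u @ v, u' @ v') \<in> gfl (functor_kernel C D T)"
    using M uv eq Mor_plus_nonempty[OF M(1)] Mor_plus_nonempty[OF M(2)]
      Mor_plus_nonempty[OF M(3)] Mor_plus_nonempty[OF M(4)]
    by (simp add: Mor_plus_append path_val_append kernel_ob_def)
qed

end

locale surjective_functor = cat_functor +
  assumes ob_surj: "Ob D \<subseteq> onob T ` Ob C"
    and mor_surj: "Mor D \<subseteq> onmor T ` Mor C"
begin

interpretation ker: generalized_congruence C "functor_kernel C D T"
  by (rule kernel_congruence)

lemma fibre_ob: "a \<in> Ob C \<Longrightarrow> onob (fibre_functor C D T) (onob T a) = kernel_ob C T `` {a}"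
  using ob_map by (auto simp: fibre_functor_def kernel_ob_def)

lemma fibre_mor: "u \<in> Mor_plus C (kernel_ob C T) \<Longrightarrow>
    onmor (fibre_functor C D T) (path_val D T u) = gfl (functor_kernel C D T) `` {u}"
  using path_val_ends[of u] by (auto simp: fibre_functor_def)

lemma fibre_mor_single: "f \<in> Mor C \<Longrightarrow>
    onmor (fibre_functor C D T) (onmor T f) = gfl (functor_kernel C D T) `` {[f]}"
  using fibre_mor[of "[f]"] by simp

lemma hom_lift:
  assumes "A \<in> Ob D" "B \<in> Ob D" "X \<in> Hom D A B"
  obtains f where "f \<in> Mor C" "X = onmor T f" "A = onob T (sc C f)" "B = onob T (tg C f)"
proof -
  obtain f where "f \<in> Mor C" "X = onmor T f"
    using assms mor_surj target.hom_Mor by blast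
  then show thesis
    using that sc_map tg_map assms target.sc_eq target.tg_eq by metis
qed

lemma fibre_cat_functor: "cat_functor D (gcong_quotient C (functor_kernel C D T)) (fibre_functor C D T)"
proof -
  interpret Q: category "gcong_quotient C (functor_kernel C D T)" by (rule ker.quotient_category)
  let ?F = "fibre_functor C D T" and ?Q = "gcong_quotient C (functor_kernel C D T)"
  show ?thesis
  proof
    show "onob ?F \<in> extensional (Ob D)" "onmor ?F \<in> extensional (Mor D)"
      by (auto simp: fibre_functor_def)
    fix A assume "A \<in> Ob D"
    then obtain a where a: "a \<in> Ob C" "A = onob T a" using ob_surj by auto
    show "onob ?F A \<in> Ob ?Q"
      using a fibre_ob by (auto intro: quotientI)
    show "onmor ?F (idm D A) = idm ?Q (onob ?F A)"
      using a fibre_ob fibre_mor_single[of "idm C a"] ker.quotient_id[OF ker.gob_refl, of a]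
      by (auto simp: map_id source.id_Mor)
  next
    fix A B X assume "A \<in> Ob D" "B \<in> Ob D" "X \<in> Hom D A B"
    then obtain f where f: "f \<in> Mor C" "X = onmor T f" "A = onob T (sc C f)" "B = onob T (tg C f)"
      by (rule hom_lift)
    then show "onmor ?F X \<in> Hom ?Q (onob ?F A) (onob ?F B)"
      unfolding ker.quotient_Hom using ker.gob_refl source.sc_ob source.tg_ob
      by (intro bexI[of _ "[f]"]) (auto simp: fibre_mor_single fibre_ob)
  next
    fix A B E X Y
    assume *: "A \<in> Ob D" "B \<in> Ob D" "E \<in> Ob D" "X \<in> Hom D A B" "Y \<in> Hom D B E"
    obtain f where f: "f \<in> Mor C" "X = onmor T f" "B = onob T (tg C f)"
      using hom_lift[OF *(1,2,4)] by blast
    obtain g where g: "g \<in> Mor C" "Y = onmor T g" "B = onob T (sc C g)"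
      using hom_lift[OF *(2,3,5)] by blast
    have k: "(tg C f, sc C g) \<in> kernel_ob C T"
      using f g source.sc_ob source.tg_ob by (auto simp: kernel_ob_def)
    have "cmp D Y X = path_val D T [f, g]"
      using f g by simp
    then have "onmor ?F (cmp D Y X) = gfl (functor_kernel C D T) `` {[f] @ [g]}"
      using f g k fibre_mor[of "[f, g]"] by (simp add: Mor_plus_Cons)
    also have "\<dots> = cmp ?Q (gfl (functor_kernel C D T) `` {[g]}) (gfl (functor_kernel C D T) `` {[f]})"
      using f g k by (subst ker.quotient_cmp) simp_all
    finally show "onmor ?F (cmp D Y X) = cmp ?Q (onmor ?F Y) (onmor ?F X)"
      using f g fibre_mor_single by simp
  qed
qed

text \<open>
  Surjectivity makes all fibres nonempty, so a fibre determines the object or morphism it lies over.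
  Conversely the class of a sequence \<open>u\<close> is the fibre over its composite.
\<close>

lemma fibre_equivalence:
  "equivalence_functor D (gcong_quotient C (functor_kernel C D T)) (fibre_functor C D T)"
proof -
  let ?F = "fibre_functor C D T" and ?Q = "gcong_quotient C (functor_kernel C D T)"
  interpret F: cat_functor D ?Q ?F by (rule fibre_cat_functor)
  show ?thesis
  proof (rule F.bijective_equivalence)
    have "inj_on (onob ?F) (Ob D)"
    proof (rule inj_onI)
      fix A B assume AB: "A \<in> Ob D" "B \<in> Ob D" "onob ?F A = onob ?F B"
      obtain a where a: "a \<in> Ob C" "A = onob T a" using ob_surj AB by blast
      then have "a \<in> onob ?F A" using AB(1) by (simp add: fibre_functor_def)
      then have "a \<in> onob ?F B" using AB(3) by simp
      then show "A = B" using AB(2) a(2) by (simp add: fibre_functor_def)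
    qed
    moreover have "K \<in> onob ?F ` Ob D" if K: "K \<in> Ob ?Q" for K
    proof -
      obtain a where "a \<in> Ob C" "K = kernel_ob C T `` {a}" using K by (auto elim: quotientE)
      then show ?thesis using fibre_ob ob_map by blast
    qed
    ultimately show "bij_betw (onob ?F) (Ob D) (Ob ?Q)"
      using F.ob_map by (auto simp: bij_betw_def)
    have "inj_on (onmor ?F) (Mor D)"
    proof (rule inj_onI)
      fix X Y assume XY: "X \<in> Mor D" "Y \<in> Mor D" "onmor ?F X = onmor ?F Y"
      obtain f where "f \<in> Mor C" "X = onmor T f" using mor_surj XY by blast
      then have "[f] \<in> onmor ?F X" using XY(1) by (simp add: fibre_functor_def)
      then have "[f] \<in> onmor ?F Y" using XY(3) by simp
      then show "X = Y" using XY(2) \<open>X = onmor T f\<close> by (simp add: fibre_functor_def)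
    qed
    moreover have "W \<in> onmor ?F ` Mor D" if "W \<in> Mor ?Q" for W
    proof -
      obtain u where "u \<in> Mor_plus C (kernel_ob C T)" "W = gfl (functor_kernel C D T) `` {u}"
        using \<open>W \<in> Mor ?Q\<close> unfolding F.target.Mor_iff ker.quotient_Hom by auto
      then show ?thesis using fibre_mor path_val_ends by blast
    qed
    ultimately show "bij_betw (onmor ?F) (Mor D) (Mor ?Q)"
      using F.onmor_Mor by (auto simp: bij_betw_def)
  qed
qed

lemma fibre_factors: "func_comp C (fibre_functor C D T) T = gcong_proj C (functor_kernel C D T)"
  by (auto simp: func_comp_def gcong_proj_def compose_def fibre_ob fibre_mor_single
      cong: restrict_cong)

lemma factor_unique:
  assumes "cat_functor D Q S" "cat_functor D Q S'" "func_comp C S T = func_comp C S' T"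
  shows "S = S'"
proof -
  interpret S: cat_functor D Q S by fact
  interpret S': cat_functor D Q S' by fact
  have "onob S (onob T a) = onob S' (onob T a)" if "a \<in> Ob C" for a
    using assms(3) that unfolding func_comp_def compose_def
    by (metis (no_types, lifting) func.select_convs(1) restrict_apply')
  then have "onob S = onob S'"
    using ob_surj by (intro extensionalityI[OF S.ob_extensional S'.ob_extensional]) blast
  moreover have "onmor S (onmor T f) = onmor S' (onmor T f)" if "f \<in> Mor C" for f
    using assms(3) that unfolding func_comp_def compose_def
    by (metis (no_types, lifting) func.select_convs(2) restrict_apply')
  then have "onmor S = onmor S'"
    using mor_surj by (intro extensionalityI[OF S.mor_extensional S'.mor_extensional]) blast
  ultimately show ?thesis by simp
qed

end

section \<open>The Riguet quotient is a category\<close>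

text \<open>
  The relation that \<open>\<Phi>\<close> induces on all morphisms, with the indices read off from the morphisms. It
  turns (Rb)-(Re) into statements without object parameters: an equivalence relation on
  the morphisms, compatible with composition.
\<close>

definition flow :: "('o, 'm) cat \<Rightarrow> ('o, 'm) riguet \<Rightarrow> 'm \<Rightarrow> 'm \<Rightarrow> bool" where
  "flow C \<Phi> f g \<longleftrightarrow> f \<in> Mor C \<and> g \<in> Mor C \<and> (sc C f, sc C g) \<in> rob \<Phi> \<and> (tg C f, tg C g) \<in> rob \<Phi> \<and>
    (f, g) \<in> rfl \<Phi> (sc C f) (tg C f) (sc C g) (tg C g)"

context riguet_congruence
begin

abbreviation "Q \<equiv> riguet_quotient C \<Phi>"
abbreviation "cls \<equiv> riguet_class C \<Phi>"

lemma rob_sub: "(a, b) \<in> rob \<Phi> \<Longrightarrow> a \<in> Ob C \<and> b \<in> Ob C"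
  using rob_equiv by (auto simp: equiv_def refl_on_def)

lemma rob_refl: "a \<in> Ob C \<Longrightarrow> (a, a) \<in> rob \<Phi>"
  using rob_equiv by (auto simp: equiv_def refl_on_def)

lemma rob_sym: "(a, b) \<in> rob \<Phi> \<Longrightarrow> (b, a) \<in> rob \<Phi>"
  using rob_equiv by (auto simp: equiv_def sym_def)

lemma rob_trans: "\<lbrakk>(a, b) \<in> rob \<Phi>; (b, c) \<in> rob \<Phi>\<rbrakk> \<Longrightarrow> (a, c) \<in> rob \<Phi>"
  using rob_equiv unfolding equiv_def by (blast dest: transD)

lemma rob_class_eq: "a \<in> Ob C \<Longrightarrow> b \<in> Ob C \<Longrightarrow> rob \<Phi> `` {a} = rob \<Phi> `` {b} \<longleftrightarrow> (a, b) \<in> rob \<Phi>"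
  using rob_equiv by (simp add: eq_equiv_class_iff)

lemma rfl_flow:
  assumes "(a, a') \<in> rob \<Phi>" "(b, b') \<in> rob \<Phi>" "(f, g) \<in> rfl \<Phi> a b a' b'"
  shows "flow C \<Phi> f g \<and> sc C f = a \<and> tg C f = b \<and> sc C g = a' \<and> tg C g = b'"
proof -
  have fg: "f \<in> Hom C a b" "g \<in> Hom C a' b'" and ob: "a \<in> Ob C" "b \<in> Ob C" "a' \<in> Ob C" "b' \<in> Ob C"
    using rfl_sub[OF assms(1,2)] assms rob_sub by auto
  then show ?thesis
    using assms by (simp add: flow_def sc_eq[OF fg(1)] sc_eq[OF fg(2)] tg_eq[OF fg(1)] tg_eq[OF fg(2)]
        hom_Mor[OF fg(1)] hom_Mor[OF fg(2)])
qed

lemma flow_refl: "f \<in> Mor C \<Longrightarrow> flow C \<Phi> f f"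
  unfolding flow_def using Rb Mor_hom sc_ob tg_ob rob_refl by blast

lemma flow_sym: "flow C \<Phi> f g \<Longrightarrow> flow C \<Phi> g f"
  unfolding flow_def using Rc rob_sym by blast

lemma flow_trans: "\<lbrakk>flow C \<Phi> f g; flow C \<Phi> g h\<rbrakk> \<Longrightarrow> flow C \<Phi> f h"
  unfolding flow_def using Rd rob_trans by meson

lemma flow_cmp:
  assumes "flow C \<Phi> f f'" "flow C \<Phi> g g'" "tg C f = sc C g" "tg C f' = sc C g'"
  shows "flow C \<Phi> (cmp C g f) (cmp C g' f')"
proof -
  have "(cmp C g f, cmp C g' f') \<in> rfl \<Phi> (sc C f) (tg C g) (sc C f') (tg C g')"
    using assms Re[of "sc C f" "sc C f'" "tg C f" "tg C f'" "tg C g" "tg C g'" f f' g g']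
    by (auto simp: flow_def)
  moreover have "(sc C f, sc C f') \<in> rob \<Phi>" "(tg C g, tg C g') \<in> rob \<Phi>"
    using assms by (simp_all add: flow_def)
  ultimately show ?thesis
    using rfl_flow by blast
qed

lemma flow_transport:
  assumes "f \<in> Mor C" "(sc C f, a) \<in> rob \<Phi>" "(tg C f, b) \<in> rob \<Phi>"
  obtains h where "flow C \<Phi> f h" "sc C h = a" "tg C h = b"
  using Rf[OF assms(2,3) Mor_hom[OF assms(1)]] rfl_flow[OF assms(2,3)] by blast

lemma flow_id: "(a, b) \<in> rob \<Phi> \<Longrightarrow> flow C \<Phi> (idm C a) (idm C b)"
  using rfl_flow[OF _ _ Ra] by blast

lemma riguet_rel_flow:
  assumes "a \<in> Ob C" "b \<in> Ob C"
  shows "(f, g) \<in> riguet_rel \<Phi> (rob \<Phi> `` {a}) (rob \<Phi> `` {b}) \<longleftrightarrow>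
    flow C \<Phi> f g \<and> (a, sc C f) \<in> rob \<Phi> \<and> (b, tg C f) \<in> rob \<Phi>" (is "?L \<longleftrightarrow> ?R")
proof
  assume ?L
  then obtain a' a'' b' b'' where *: "(a, a') \<in> rob \<Phi>" "(a, a'') \<in> rob \<Phi>" "(b, b') \<in> rob \<Phi>" "(b, b'') \<in> rob \<Phi>"
    "(f, g) \<in> rfl \<Phi> a' b' a'' b''" unfolding riguet_rel_def by blast
  then have "(a', a'') \<in> rob \<Phi>" "(b', b'') \<in> rob \<Phi>" using rob_sym rob_trans by meson+
  then show ?R using rfl_flow[of a' a'' b' b''] * by auto
next
  assume R: ?R
  then have "(a, sc C g) \<in> rob \<Phi>" "(b, tg C g) \<in> rob \<Phi>"
    unfolding flow_def using rob_trans by blast+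
  then have "sc C f \<in> rob \<Phi> `` {a}" "sc C g \<in> rob \<Phi> `` {a}"
    "tg C f \<in> rob \<Phi> `` {b}" "tg C g \<in> rob \<Phi> `` {b}"
    using R by simp_all
  moreover have "(f, g) \<in> rfl \<Phi> (sc C f) (tg C f) (sc C g) (tg C g)"
    using R by (simp add: flow_def)
  ultimately show ?L
    unfolding riguet_rel_def by (intro UN_I)
qed

lemma cls_eq:
  assumes "f \<in> Mor C"
  shows "cls f = {g. flow C \<Phi> f g}"
  unfolding riguet_class_def set_eq_iff Image_singleton_iff mem_Collect_eq
  by (simp add: riguet_rel_flow sc_ob[OF assms] tg_ob[OF assms] rob_refl)

lemma cls_eqI:
  assumes fg: "flow C \<Phi> f g"
  shows "cls f = cls g"
proof -
  have "flow C \<Phi> f h \<longleftrightarrow> flow C \<Phi> g h" for h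
    using flow_trans[OF fg, of h] flow_trans[OF flow_sym[OF fg], of h] by blast
  moreover have "f \<in> Mor C" "g \<in> Mor C" using fg by (simp_all add: flow_def)
  ultimately show ?thesis by (simp add: cls_eq)
qed

lemma cls_eq_iff:
  assumes "f \<in> Mor C" "g \<in> Mor C"
  shows "cls f = cls g \<longleftrightarrow> flow C \<Phi> f g"
proof
  assume "cls f = cls g"
  then have "g \<in> cls f" using flow_refl[OF assms(2)] assms by (simp add: cls_eq)
  then show "flow C \<Phi> f g" using assms by (simp add: cls_eq)
qed (rule cls_eqI)

lemma Q_Ob [simp]: "Ob Q = Ob C // rob \<Phi>"
  by (simp add: riguet_quotient_def)

lemma Q_Hom:
  assumes "a \<in> Ob C" "b \<in> Ob C"
  shows "X \<in> Hom Q (rob \<Phi> `` {a}) (rob \<Phi> `` {b}) \<longleftrightarrow>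
    (\<exists>f \<in> Mor C. X = cls f \<and> (a, sc C f) \<in> rob \<Phi> \<and> (b, tg C f) \<in> rob \<Phi>)" (is "?L \<longleftrightarrow> ?R")
proof -
  let ?S = "riguet_rel \<Phi> (rob \<Phi> `` {a}) (rob \<Phi> `` {b})"
  have cls: "?S `` {f} = cls f" if "f \<in> Mor C" "(a, sc C f) \<in> rob \<Phi>" "(b, tg C f) \<in> rob \<Phi>" for f
    using that assms by (auto simp: cls_eq riguet_rel_flow)
  have un: "f \<in> (\<Union>a' \<in> rob \<Phi> `` {a}. \<Union>b' \<in> rob \<Phi> `` {b}. Hom C a' b') \<longleftrightarrow>
      f \<in> Mor C \<and> (a, sc C f) \<in> rob \<Phi> \<and> (b, tg C f) \<in> rob \<Phi>" (is "f \<in> ?U \<longleftrightarrow> _") for f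
  proof
    assume "f \<in> ?U"
    then obtain a' b' where "(a, a') \<in> rob \<Phi>" "(b, b') \<in> rob \<Phi>" "f \<in> Hom C a' b'" by blast
    then show "f \<in> Mor C \<and> (a, sc C f) \<in> rob \<Phi> \<and> (b, tg C f) \<in> rob \<Phi>"
      using rob_sub hom_Mor sc_eq tg_eq by metis
  next
    assume "f \<in> Mor C \<and> (a, sc C f) \<in> rob \<Phi> \<and> (b, tg C f) \<in> rob \<Phi>"
    then show "f \<in> ?U" using Mor_hom by blast
  qed
  have "?L \<longleftrightarrow> (\<exists>f \<in> (\<Union>a' \<in> rob \<Phi> `` {a}. \<Union>b' \<in> rob \<Phi> `` {b}. Hom C a' b'). X = ?S `` {f})"
    by (simp add: riguet_quotient_def quotient_def)
  also have "\<dots> \<longleftrightarrow> ?R"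
    unfolding Bex_def un using cls by blast
  finally show ?thesis .
qed

lemma Q_id: "a \<in> Ob C \<Longrightarrow> idm Q (rob \<Phi> `` {a}) = cls (idm C a)"
proof -
  assume a: "a \<in> Ob C"
  have "cls (idm C b) = cls (idm C a)" if "(a, b) \<in> rob \<Phi>" for b
    by (rule cls_eqI[OF flow_id[OF rob_sym[OF that]]])
  then have "(\<Union>b \<in> rob \<Phi> `` {a}. cls (idm C b)) = (\<Union>b \<in> rob \<Phi> `` {a}. cls (idm C a))"
    by (intro SUP_cong refl) simp
  moreover have "rob \<Phi> `` {a} \<noteq> {}" using rob_refl[OF a] by blast
  ultimately show ?thesis
    by (simp add: riguet_quotient_def)
qed

text \<open>
  Well-definedness of the composition: for other representatives \<open>g'\<close>, \<open>f'\<close> and another auxiliary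
  morphism \<open>k\<close>, transitivity relates \<open>h\<close> to \<open>k\<close>, and (Re) then relates \<open>g \<circ> h\<close> to \<open>g' \<circ> k\<close>.
\<close>

lemma Q_cmp:
  assumes g: "g \<in> Mor C" and h: "flow C \<Phi> f h" "tg C h = sc C g"
  shows "cmp Q (cls g) (cls f) = cls (cmp C g h)"
proof -
  have f: "f \<in> Mor C" "h \<in> Mor C" using h by (auto simp: flow_def)
  define H where "H f g = {k \<in> Hom C (sc C f) (sc C g).
    (f, k) \<in> rfl \<Phi> (sc C f) (tg C f) (sc C f) (sc C g)}" for f g
  have 1: "cls (cmp C g' k) = cls (cmp C g h)"
    if g': "flow C \<Phi> g g'" and f': "flow C \<Phi> f f'" and k: "k \<in> H f' g'" for f' g' k
  proof -
    have "(tg C f', tg C f) \<in> rob \<Phi>" "(tg C f, sc C g) \<in> rob \<Phi>" "(sc C g, sc C g') \<in> rob \<Phi>"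
      using f' g' h rob_sym by (auto simp: flow_def)
    then have r: "(tg C f', sc C g') \<in> rob \<Phi>" using rob_trans by meson
    have M: "f' \<in> Mor C" "g' \<in> Mor C" using f' g' by (auto simp: flow_def)
    have k': "flow C \<Phi> f' k" "tg C k = sc C g'"
      using k rfl_flow[OF rob_refl r] sc_ob M by (auto simp: H_def)
    have "flow C \<Phi> h k" using k' f' h flow_sym flow_trans by meson
    then have "flow C \<Phi> (cmp C g h) (cmp C g' k)"
      using g' flow_cmp h k' by simp
    then show ?thesis by (rule cls_eqI[symmetric])
  qed
  have r: "(tg C f, sc C g) \<in> rob \<Phi>" using h by (simp add: flow_def)
  obtain k where k: "flow C \<Phi> f k" "sc C k = sc C f" "tg C k = sc C g"
    using flow_transport[OF f(1) rob_refl r] f sc_ob by blast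
  have kH: "k \<in> H f g"
    using k Mor_hom[of k] by (auto simp: H_def flow_def)
  have "cmp Q (cls g) (cls f) =
      (\<Union>g' \<in> {g'. flow C \<Phi> g g'}. \<Union>f' \<in> {f'. flow C \<Phi> f f'}. \<Union>k \<in> H f' g'. cls (cmp C g' k))"
    using f g by (simp add: riguet_quotient_def H_def cls_eq)
  also have "\<dots> = cls (cmp C g h)"
  proof (rule set_eqI, rule iffI)
    fix x assume "x \<in> (\<Union>g' \<in> {g'. flow C \<Phi> g g'}. \<Union>f' \<in> {f'. flow C \<Phi> f f'}.
      \<Union>k \<in> H f' g'. cls (cmp C g' k))"
    then obtain g' f' k where "flow C \<Phi> g g'" "flow C \<Phi> f f'" "k \<in> H f' g'" "x \<in> cls (cmp C g' k)"
      by (elim UN_E CollectE)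
    then show "x \<in> cls (cmp C g h)" using 1 by simp
  next
    fix x assume "x \<in> cls (cmp C g h)"
    then have "x \<in> cls (cmp C g k)"
      using 1[OF flow_refl[OF g] flow_refl[OF f(1)] kH] by simp
    then show "x \<in> (\<Union>g' \<in> {g'. flow C \<Phi> g g'}. \<Union>f' \<in> {f'. flow C \<Phi> f f'}.
      \<Union>k \<in> H f' g'. cls (cmp C g' k))"
      using flow_refl[OF f(1)] flow_refl[OF g] kH by (intro UN_I CollectI)
  qed
  finally show ?thesis .
qed

lemma Q_cmp_strict:
  "\<lbrakk>f \<in> Mor C; g \<in> Mor C; tg C f = sc C g\<rbrakk> \<Longrightarrow> cmp Q (cls g) (cls f) = cls (cmp C g f)"
  using Q_cmp flow_refl by blast

lemma Q_ObE:
  assumes "A \<in> Ob Q"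
  obtains a where "a \<in> Ob C" "A = rob \<Phi> `` {a}"
  using assms by (auto elim: quotientE)

text \<open>
  By (Rf), a morphism of the quotient has a representative between any chosen representatives of its
  ends. Composable morphisms of the quotient thus lift to strictly composable ones, and the category
  laws are inherited from \<open>C\<close>.
\<close>

lemma Q_lift:
  assumes "a \<in> Ob C" "b \<in> Ob C" "X \<in> Hom Q (rob \<Phi> `` {a}) (rob \<Phi> `` {b})"
  obtains f where "f \<in> Mor C" "X = cls f" "sc C f = a" "tg C f = b"
proof -
  obtain f where f: "f \<in> Mor C" "X = cls f" "(sc C f, a) \<in> rob \<Phi>" "(tg C f, b) \<in> rob \<Phi>"
    using assms rob_sym unfolding Q_Hom[OF assms(1,2)] by blast
  obtain h where "flow C \<Phi> f h" "sc C h = a" "tg C h = b"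
    using flow_transport[OF f(1,3,4)] by blast
  then show thesis
    using that[of h] f(2) cls_eqI[of f h] by (simp add: flow_def)
qed

lemma cls_hom:
  "f \<in> Mor C \<Longrightarrow> cls f \<in> Hom Q (rob \<Phi> `` {sc C f}) (rob \<Phi> `` {tg C f})"
  using Q_Hom[OF sc_ob tg_ob, of f f "cls f"] rob_refl[OF sc_ob, of f] rob_refl[OF tg_ob, of f] by auto

lemma Q_category: "category Q"
proof
  fix A B A' B'
  assume A: "A \<in> Ob Q" "B \<in> Ob Q" "A' \<in> Ob Q" "B' \<in> Ob Q" and ne: "(A, B) \<noteq> (A', B')"
  obtain a where a: "a \<in> Ob C" "A = rob \<Phi> `` {a}" using A(1) by (rule Q_ObE)
  obtain b where b: "b \<in> Ob C" "B = rob \<Phi> `` {b}" using A(2) by (rule Q_ObE)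
  obtain a' where a': "a' \<in> Ob C" "A' = rob \<Phi> `` {a'}" using A(3) by (rule Q_ObE)
  obtain b' where b': "b' \<in> Ob C" "B' = rob \<Phi> `` {b'}" using A(4) by (rule Q_ObE)
  show "Hom Q A B \<inter> Hom Q A' B' = {}"
  proof (rule ccontr)
    assume "Hom Q A B \<inter> Hom Q A' B' \<noteq> {}"
    then obtain X where X: "X \<in> Hom Q A B" "X \<in> Hom Q A' B'" by blast
    obtain f where f: "f \<in> Mor C" "X = cls f" "sc C f = a" "tg C f = b"
      by (rule Q_lift[OF a(1) b(1) X(1)[unfolded a(2) b(2)]])
    obtain g where g: "g \<in> Mor C" "X = cls g" "sc C g = a'" "tg C g = b'"
      by (rule Q_lift[OF a'(1) b'(1) X(2)[unfolded a'(2) b'(2)]])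
    have "flow C \<Phi> f g" using cls_eq_iff[OF f(1) g(1)] f(2) g(2) by blast
    then have "(a, a') \<in> rob \<Phi>" "(b, b') \<in> rob \<Phi>" using f(3,4) g(3,4) by (simp_all add: flow_def)
    then have "A = A'" "B = B'" using a b a' b' rob_class_eq by simp_all
    then show False using ne by simp
  qed
next
  fix A assume "A \<in> Ob Q"
  then obtain a where a: "a \<in> Ob C" "A = rob \<Phi> `` {a}" by (rule Q_ObE)
  then show "idm Q A \<in> Hom Q A A"
    using cls_hom[of "idm C a"] by (simp add: Q_id id_Mor sc_id tg_id)
next
  fix A B E X Y
  assume *: "A \<in> Ob Q" "B \<in> Ob Q" "E \<in> Ob Q" "X \<in> Hom Q A B" "Y \<in> Hom Q B E"
  obtain a where a: "a \<in> Ob C" "A = rob \<Phi> `` {a}" using *(1) by (rule Q_ObE)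
  obtain b where b: "b \<in> Ob C" "B = rob \<Phi> `` {b}" using *(2) by (rule Q_ObE)
  obtain e where e: "e \<in> Ob C" "E = rob \<Phi> `` {e}" using *(3) by (rule Q_ObE)
  obtain f where f: "f \<in> Mor C" "X = cls f" "sc C f = a" "tg C f = b"
    by (rule Q_lift[OF a(1) b(1) *(4)[unfolded a(2) b(2)]])
  obtain g where g: "g \<in> Mor C" "Y = cls g" "sc C g = b" "tg C g = e"
    by (rule Q_lift[OF b(1) e(1) *(5)[unfolded b(2) e(2)]])
  show "cmp Q Y X \<in> Hom Q A E"
    using cls_hom[of "cmp C g f"] f g a e by (simp add: Q_cmp_strict cmp_Mor sc_cmp tg_cmp)
next
  fix A B X assume *: "A \<in> Ob Q" "B \<in> Ob Q" "X \<in> Hom Q A B"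
  obtain a where a: "a \<in> Ob C" "A = rob \<Phi> `` {a}" using *(1) by (rule Q_ObE)
  obtain b where b: "b \<in> Ob C" "B = rob \<Phi> `` {b}" using *(2) by (rule Q_ObE)
  obtain f where f: "f \<in> Mor C" "X = cls f" "sc C f = a" "tg C f = b"
    by (rule Q_lift[OF a(1) b(1) *(3)[unfolded a(2) b(2)]])
  have h: "f \<in> Hom C a b" using f Mor_hom by blast
  show "cmp Q X (idm Q A) = X" "cmp Q (idm Q B) X = X"
    using f a b h by (simp_all add: Q_id Q_cmp_strict id_Mor sc_id tg_id id_left id_right)
next
  fix A B E G X Y Z
  assume *: "A \<in> Ob Q" "B \<in> Ob Q" "E \<in> Ob Q" "G \<in> Ob Q"
    "X \<in> Hom Q A B" "Y \<in> Hom Q B E" "Z \<in> Hom Q E G"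
  obtain a where a: "a \<in> Ob C" "A = rob \<Phi> `` {a}" using *(1) by (rule Q_ObE)
  obtain b where b: "b \<in> Ob C" "B = rob \<Phi> `` {b}" using *(2) by (rule Q_ObE)
  obtain e where e: "e \<in> Ob C" "E = rob \<Phi> `` {e}" using *(3) by (rule Q_ObE)
  obtain d where d: "d \<in> Ob C" "G = rob \<Phi> `` {d}" using *(4) by (rule Q_ObE)
  obtain f where f: "f \<in> Mor C" "X = cls f" "sc C f = a" "tg C f = b"
    by (rule Q_lift[OF a(1) b(1) *(5)[unfolded a(2) b(2)]])
  obtain g where g: "g \<in> Mor C" "Y = cls g" "sc C g = b" "tg C g = e"
    by (rule Q_lift[OF b(1) e(1) *(6)[unfolded b(2) e(2)]])
  obtain h where h: "h \<in> Mor C" "Z = cls h" "sc C h = e" "tg C h = d"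
    by (rule Q_lift[OF e(1) d(1) *(7)[unfolded e(2) d(2)]])
  have "cmp C h (cmp C g f) = cmp C (cmp C h g) f"
    using Mor_hom[OF f(1)] Mor_hom[OF g(1)] Mor_hom[OF h(1)] cmp_assoc[OF a(1) b(1) e(1) d(1)]
    unfolding f(3,4) g(3,4) h(3,4) by blast
  then show "cmp Q Z (cmp Q Y X) = cmp Q (cmp Q Z Y) X"
    using f g h by (simp add: Q_cmp_strict cmp_Mor sc_cmp tg_cmp)
qed

lemma riguet_proj_functor: "surjective_functor C Q (riguet_proj C \<Phi>)" (is "surjective_functor C Q ?P")
proof -
  interpret Q: category Q by (rule Q_category)
  show ?thesis
  proof
    show "onob ?P \<in> extensional (Ob C)" "onmor ?P \<in> extensional (Mor C)"
      by (auto simp: riguet_proj_def)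
    fix a assume a: "a \<in> Ob C"
    show "onob ?P a \<in> Ob Q" using a by (auto simp: riguet_proj_def intro: quotientI)
    show "onmor ?P (idm C a) = idm Q (onob ?P a)"
      using a by (simp add: riguet_proj_def Q_id id_Mor)
  next
    fix a b f assume "a \<in> Ob C" "b \<in> Ob C" "f \<in> Hom C a b"
    then show "onmor ?P f \<in> Hom Q (onob ?P a) (onob ?P b)"
      using cls_hom[of f] hom_Mor sc_eq tg_eq by (auto simp: riguet_proj_def)
  next
    fix a b c f g assume *: "a \<in> Ob C" "b \<in> Ob C" "c \<in> Ob C" "f \<in> Hom C a b" "g \<in> Hom C b c"
    then have "f \<in> Mor C" "g \<in> Mor C" "tg C f = sc C g" using hom_Mor sc_eq tg_eq by metis+
    then show "onmor ?P (cmp C g f) = cmp Q (onmor ?P g) (onmor ?P f)"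
      by (simp add: riguet_proj_def cmp_Mor Q_cmp_strict)
  next
    show "Ob Q \<subseteq> onob ?P ` Ob C"
      by (auto simp: riguet_proj_def elim!: quotientE)
    show "Mor Q \<subseteq> onmor ?P ` Mor C"
    proof
      fix X assume "X \<in> Mor Q"
      then obtain A B where A: "A \<in> Ob Q" and B: "B \<in> Ob Q" and X: "X \<in> Hom Q A B" by (auto simp: Q.Mor_iff)
      obtain a where a: "a \<in> Ob C" "A = rob \<Phi> `` {a}" using A by (rule Q_ObE)
      obtain b where b: "b \<in> Ob C" "B = rob \<Phi> `` {b}" using B by (rule Q_ObE)
      obtain f where "f \<in> Mor C" "X = cls f" using Q_lift X a b by metis
      then show "X \<in> onmor ?P ` Mor C" by (auto simp: riguet_proj_def)
    qed
  qed
qed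

end

section \<open>The generated congruence is the kernel of the projection\<close>

context riguet_congruence
begin

interpretation P: surjective_functor C Q "riguet_proj C \<Phi>"
  by (rule riguet_proj_functor)

lemma kernel_ob_proj: "kernel_ob C (riguet_proj C \<Phi>) = rob \<Phi>"
proof -
  have "(a, b) \<in> kernel_ob C (riguet_proj C \<Phi>) \<longleftrightarrow> (a, b) \<in> rob \<Phi>" for a b
    using rob_class_eq[of a b] rob_sub[of a b]
    by (cases "a \<in> Ob C \<and> b \<in> Ob C") (simp_all add: kernel_ob_def riguet_proj_def, blast)
  then show ?thesis by auto
qed

lemma proj_mor: "f \<in> Mor C \<Longrightarrow> onmor (riguet_proj C \<Phi>) f = cls f"
  by (simp add: riguet_proj_def)

lemma kernel_above: "gcong_above C \<Phi> (functor_kernel C Q (riguet_proj C \<Phi>))"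
proof -
  have "flow C \<Phi> f f'"
    if "(a, a') \<in> rob \<Phi>" "(b, b') \<in> rob \<Phi>" "(f, f') \<in> rfl \<Phi> a b a' b'" for a a' b b' f f'
    using rfl_flow that by blast
  then have "([f], [f']) \<in> gfl (functor_kernel C Q (riguet_proj C \<Phi>))"
    if "(a, a') \<in> rob \<Phi>" "(b, b') \<in> rob \<Phi>" "(f, f') \<in> rfl \<Phi> a b a' b'" for a a' b b' f f'
    using that cls_eqI[of f f'] by (fastforce simp: proj_mor flow_def)
  then show ?thesis
    unfolding gcong_above_def using P.kernel_congruence by (auto simp: kernel_ob_proj)
qed

text \<open>
  The collapse of a sequence to a single morphism, using (Rf) once per junction. The conclusion about
  sources carries the induction: the equivalence of \<open>\<Psi>\<close> may identify more objects than \<open>\<Phi>\<close> does, so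
  it would not suffice for moving the next morphism along \<open>\<Phi>\<close>.
\<close>

lemma path_reduces:
  assumes "gcong_above C \<Phi> \<Psi>" and "u \<in> Mor_plus C (rob \<Phi>)"
  obtains f where "f \<in> Mor C" "(u, [f]) \<in> gfl \<Psi>" "(sc C (hd u), sc C f) \<in> rob \<Phi>"
    "path_val Q (riguet_proj C \<Phi>) u = cls f"
proof -
  interpret G: generalized_congruence C \<Psi> using assms(1) by (simp add: gcong_above_def)
  have sub: "rob \<Phi> \<subseteq> gob \<Psi>" using assms(1) by (simp add: gcong_above_def)
  have fl: "([f], [h]) \<in> gfl \<Psi>" if "flow C \<Phi> f h" for f h
    using assms(1) that unfolding gcong_above_def flow_def by fast
  have "\<exists>f \<in> Mor C. (u, [f]) \<in> gfl \<Psi> \<and> (sc C (hd u), sc C f) \<in> rob \<Phi> \<and>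
      path_val Q (riguet_proj C \<Phi>) u = cls f"
    using assms(2)
  proof (induction rule: Mor_plus_induct)
    case (single f)
    then show ?case using G.gfl_refl rob_refl sc_ob by (intro bexI[of _ f]) (auto simp: proj_mor)
  next
    case (Cons f v)
    then obtain g where g: "g \<in> Mor C" "(v, [g]) \<in> gfl \<Psi>" "(sc C (hd v), sc C g) \<in> rob \<Phi>"
      "path_val Q (riguet_proj C \<Phi>) v = cls g" by blast
    have r: "(tg C f, sc C g) \<in> rob \<Phi>" using Cons g rob_trans by blast
    obtain h where h: "flow C \<Phi> f h" "sc C h = sc C f" "tg C h = sc C g"
      using flow_transport[OF Cons(1) rob_refl r] Cons(1) sc_ob by blast
    have hM: "h \<in> Mor C" using h by (simp add: flow_def)
    have "([f] @ v, [h] @ [g]) \<in> gfl \<Psi>"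
      using G.Gd[OF fl[OF h(1)] g(2)] Cons(3) sub by auto
    then have "(f # v, [cmp C g h]) \<in> gfl \<Psi>"
      using G.gfl_trans[OF _ G.Gc[OF hM g(1)]] h by simp
    moreover have "path_val Q (riguet_proj C \<Phi>) (f # v) = cls (cmp C g h)"
      using Mor_plus_nonempty[OF Cons(2)] g h Cons(1) by (simp add: path_val_Cons proj_mor Q_cmp)
    ultimately show ?case
      using hM g h rob_refl sc_ob Cons(1)
      by (intro bexI[of _ "cmp C g h"]) (auto simp: cmp_Mor sc_cmp)
  qed
  then show thesis using that by blast
qed

text \<open>
  Sequences with equal composites collapse to morphisms \<open>f\<close>, \<open>g\<close> of the same class, and such
  morphisms are related by \<open>\<Phi>\<close>, hence by \<open>\<Psi>\<close>.
\<close>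

lemma kernel_least:
  assumes "gcong_above C \<Phi> \<Psi>"
  shows "gfl (functor_kernel C Q (riguet_proj C \<Phi>)) \<subseteq> gfl \<Psi>"
proof clarify
  interpret G: generalized_congruence C \<Psi> using assms by (simp add: gcong_above_def)
  fix u v assume "(u, v) \<in> gfl (functor_kernel C Q (riguet_proj C \<Phi>))"
  then have uv: "u \<in> Mor_plus C (rob \<Phi>)" "v \<in> Mor_plus C (rob \<Phi>)"
    "path_val Q (riguet_proj C \<Phi>) u = path_val Q (riguet_proj C \<Phi>) v"
    by (auto simp: kernel_ob_proj)
  obtain f where f: "f \<in> Mor C" "(u, [f]) \<in> gfl \<Psi>" "path_val Q (riguet_proj C \<Phi>) u = cls f"
    using path_reduces[OF assms uv(1)] by blast
  obtain g where g: "g \<in> Mor C" "(v, [g]) \<in> gfl \<Psi>" "path_val Q (riguet_proj C \<Phi>) v = cls g"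
    using path_reduces[OF assms uv(2)] by blast
  have "flow C \<Phi> f g" using cls_eq_iff[OF f(1) g(1)] f(3) g(3) uv(3) by simp
  then have "([f], [g]) \<in> gfl \<Psi>"
    using assms unfolding gcong_above_def flow_def by fast
  then show "(u, v) \<in> gfl \<Psi>" using f g G.gfl_trans G.gfl_sym by blast
qed

lemma natural_gcong_kernel: "natural_gcong C \<Phi> = functor_kernel C Q (riguet_proj C \<Phi>)"
  unfolding natural_gcong_def
proof (rule the_equality)
  show *: "gcong_above C \<Phi> (functor_kernel C Q (riguet_proj C \<Phi>)) \<and>
    (\<forall>\<Psi>'. gcong_above C \<Phi> \<Psi>' \<longrightarrow> gob (functor_kernel C Q (riguet_proj C \<Phi>)) \<subseteq> gob \<Psi>' \<and>
      gfl (functor_kernel C Q (riguet_proj C \<Phi>)) \<subseteq> gfl \<Psi>')"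
    using kernel_above kernel_least by (auto simp: kernel_ob_proj gcong_above_def)
  fix \<Psi> assume "gcong_above C \<Phi> \<Psi> \<and>
    (\<forall>\<Psi>'. gcong_above C \<Phi> \<Psi>' \<longrightarrow> gob \<Psi> \<subseteq> gob \<Psi>' \<and> gfl \<Psi> \<subseteq> gfl \<Psi>')"
  then have "gob \<Psi> = gob (functor_kernel C Q (riguet_proj C \<Phi>))" "gfl \<Psi> = gfl (functor_kernel C Q (riguet_proj C \<Phi>))"
    using * by (meson subset_antisym)+
  then show "\<Psi> = functor_kernel C Q (riguet_proj C \<Phi>)" by simp
qed

lemma canonical_functor_fibre: "canonical_functor C \<Phi> = fibre_functor C Q (riguet_proj C \<Phi>)"
  unfolding canonical_functor_def natural_gcong_kernel
proof (rule the_equality)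
  show "cat_functor Q (gcong_quotient C (functor_kernel C Q (riguet_proj C \<Phi>)))
      (fibre_functor C Q (riguet_proj C \<Phi>)) \<and>
    func_comp C (fibre_functor C Q (riguet_proj C \<Phi>)) (riguet_proj C \<Phi>) =
      gcong_proj C (functor_kernel C Q (riguet_proj C \<Phi>))"
    using P.fibre_cat_functor P.fibre_factors by blast
  then show "S = fibre_functor C Q (riguet_proj C \<Phi>)"
    if "cat_functor Q (gcong_quotient C (functor_kernel C Q (riguet_proj C \<Phi>))) S \<and>
      func_comp C S (riguet_proj C \<Phi>) = gcong_proj C (functor_kernel C Q (riguet_proj C \<Phi>))" for S
    using that P.factor_unique by metis
qed

lemma canonical_functor_equivalence:
  "equivalence_functor Q (gcong_quotient C (natural_gcong C \<Phi>)) (canonical_functor C \<Phi>)"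
  unfolding natural_gcong_kernel canonical_functor_fibre by (rule P.fibre_equivalence)

end

theorem corollary2p52:
  fixes C :: "('o, 'm) cat" and \<Phi> :: "('o, 'm) riguet"
  assumes "category C"
    and "riguet_congruence C \<Phi>"
    and "\<exists>F. hom_choice C \<Phi> F \<and> compatible_choice C \<Phi> F"
  shows "equivalence_functor (riguet_quotient C \<Phi>) (gcong_quotient C (natural_gcong C \<Phi>))
           (canonical_functor C \<Phi>)"
  using assms(2) by (rule riguet_congruence.canonical_functor_equivalence)

end
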